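(* Let $p\in\{0,1,\ldots,6\}$, let $\underline{\eta}\in\mathbb{S}$ and let $U$ be a domain in $\mathbb{O}$ with smooth boundary $\partial U_{\underline{\eta}}$. If $f\in C^1(U_{\underline{\eta}},\mathbb{O})$ satisfies $D_{\underline{\eta}}f(\boldsymbol{y})=0$ for all $\boldsymbol{y}\in U_{\underline{\eta}}$, then $$f(\boldsymbol{x})=\frac{1}{\sigma_{p+1}\,\epsilon^{p+1}}\int_{\partial B(\boldsymbol{x},\epsilon)}f(\boldsymbol{y})\,dS(\boldsymbol{y}),\qquad\boldsymbol{x}\in U_{\underline{\eta}},$$ where $B(\boldsymbol{x},\epsilon)=\{\boldsymbol{y}\in\mathrm{H}_{\underline{\eta}}:|\boldsymbol{y}-\boldsymbol{x}|<\epsilon\}\subset U_{\underline{\eta}}$.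
   Context: $\mathbb{O}$ is the real, non-associative, alternative algebra of octonions with basis $e_0=1,e_1,\ldots,e_7$ and product $e_ie_j=-\delta_{ij}+\sum_k\epsilon_{ijk}e_k$ for $1\le i,j\le 7$, where $\epsilon_{ijk}$ is totally antisymmetric, equals $1$ on the triples $(1,2,3),(1,4,5),(2,4,6),(3,4,7),(5,3,6),(6,1,7),(7,2,5)$, and vanishes on triples that are not permutations of these. $\mathbb{O}$ is identified with $\mathbb{R}^8$ with Euclidean norm $|\cdot|$. A domain is a connected open set. Fix $p\in\{0,\ldots,6\}$. $\mathbb{R}^{p+1}$ denotes the real span of $e_0,\ldots,e_p$, with elements $\boldsymbol{x}_p=\sum_{i=0}^px_ie_i$, and $\mathbb{S}=\{\sum_{i=p+1}^7x_ie_i:\sum_{i=p+1}^7x_i^2=1\}$. For $\underline{\eta}\in\mathbb{S}$, $\mathrm{H}_{\underline{\eta}}=\{\boldsymbol{x}_p+r\underline{\eta}:\boldsymbol{x}_p\in\mathbb{R}^{p+1},\ r\ge0\}$ is the upper half-space associated with $\underline{\eta}$. For $U\subseteq\mathbb{O}$ open, $U_{\underline{\eta}}=U\cap(\mathbb{R}^{p+1}\oplus\underline{\eta}\mathbb{R})$ is viewed as an open subset of $\mathbb{R}^{p+2}$ with coordinates $(x_0,\ldots,x_p,r)\leftrightarrow\boldsymbol{x}_p+r\underline{\eta}$. $D_{\underline{\eta}}f=\sum_{i=0}^pe_i\,\partial_{x_i}f+\underline{\eta}\,\partial_rf$. The constant $\sigma_{p+1}=2\,\Gamma(\tfrac12)^{p+2}/\Gamma(\tfrac{p+2}{2})$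 is the surface area of the unit ball in $\mathbb{R}^{p+2}$, and $dS$ is the classical Lebesgue surface element in $\mathbb{R}^{p+2}$.
   Formalization: B(x,ε) is the full ball of R^{p+1}⊕ηR, not its intersection with H_η (a truncated ball fails for f=1), and ∂B(x,ε) is also required to lie in U_η, since f is defined only there and the formula can fail if ∂B touches ∂U_η. *)

theory Defs
  imports "HOL-Analysis.Analysis"
begin

section \<open>Octonions\<close>

text \<open>The octonions are \<open>real^8\<close> with its Euclidean norm.  The componentwise product that the
  library puts on vectors plays no role here; the octonion product is \<open>\<odot>\<close>.\<close>

type_synonym octonion = "real^8"

text \<open>The index type \<open>8\<close> has the elements \<open>0, \<dots>, 7\<close>; \<open>e i\<close> is meant for \<open>i \<le> 7\<close>.\<close>

definition e :: "nat \<Rightarrow> octonion" where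
  "e i = axis (of_nat i) 1"

definition fano :: "(nat \<times> nat \<times> nat) set" where
  "fano = {(1,2,3), (1,4,5), (2,4,6), (3,4,7), (5,3,6), (6,1,7), (7,2,5)}"

definition eps :: "nat \<Rightarrow> nat \<Rightarrow> nat \<Rightarrow> real" where
  "eps i j k =
     (if (i,j,k) \<in> fano \<or> (j,k,i) \<in> fano \<or> (k,i,j) \<in> fano then 1
      else if (j,i,k) \<in> fano \<or> (i,k,j) \<in> fano \<or> (k,j,i) \<in> fano then - 1
      else 0)"

definition basis_mult :: "nat \<Rightarrow> nat \<Rightarrow> octonion" where
  "basis_mult i j =
     (if i = 0 then e j
      else if j = 0 then e i
      else - (if i = j then e 0 else 0) + (\<Sum>k=1..7. eps i j k *\<^sub>R e k))"

definition oct_mult :: "octonion \<Rightarrow> octonion \<Rightarrow> octonion"  (infixl "\<odot>" 70) where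
  "a \<odot> b = (\<Sum>i\<le>7. \<Sum>j\<le>7. ((a \<bullet> e i) * (b \<bullet> e j)) *\<^sub>R basis_mult i j)"

section \<open>Slices\<close>

definition imag_sphere :: "nat \<Rightarrow> octonion set" where
  "imag_sphere p = {(\<Sum>i=p+1..7. c i *\<^sub>R e i) | c. (\<Sum>i=p+1..7. (c i)\<^sup>2) = 1}"

text \<open>The point \<open>\<Sum>i\<le>p. z i e\<^sub>i\<close> of \<open>\<real>\<^sup>p\<^sup>+\<^sup>1\<close> with coordinates \<open>z\<close>.\<close>

definition paravec :: "nat \<Rightarrow> (nat \<Rightarrow> real) \<Rightarrow> octonion" where
  "paravec p z = (\<Sum>i\<le>p. z i *\<^sub>R e i)"

definition slice :: "nat \<Rightarrow> octonion \<Rightarrow> octonion set" where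
  "slice p \<eta> = {paravec p z + r *\<^sub>R \<eta> | z r. True}"

definition upper_half_space :: "nat \<Rightarrow> octonion \<Rightarrow> octonion set" where
  "upper_half_space p \<eta> = {paravec p z + r *\<^sub>R \<eta> | z r. r \<ge> 0}"

text \<open>Boundary relative to the slice, that is, boundary in \<open>\<real>\<^sup>p\<^sup>+\<^sup>2\<close>.\<close>

definition slice_boundary :: "nat \<Rightarrow> octonion \<Rightarrow> octonion set \<Rightarrow> octonion set" where
  "slice_boundary p \<eta> A = (top_of_set (slice p \<eta>)) frontier_of A"

text \<open>The ball of \<open>\<real>\<^sup>p\<^sup>+\<^sup>2\<close>.  Whenever it lies in the upper half-space it is the set
  of all points of the upper half-space at distance less than \<open>\<epsilon>\<close> from \<open>x\<close>
  (lemma \<open>slice_ball_eq_upper\<close>).  A ball cut off by the hyperplane \<open>r = 0\<close> is not meant: the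
  boundary of the truncated ball has a different area, so that the mean value formula would
  already fail for constant functions.\<close>

definition slice_ball :: "nat \<Rightarrow> octonion \<Rightarrow> octonion \<Rightarrow> real \<Rightarrow> octonion set" where
  "slice_ball p \<eta> x \<epsilon> = {y \<in> slice p \<eta>. norm (y - x) < \<epsilon>}"

lemma slice_ball_eq_upper:
  assumes "slice_ball p \<eta> x \<epsilon> \<subseteq> upper_half_space p \<eta>"
  shows "slice_ball p \<eta> x \<epsilon> = {y \<in> upper_half_space p \<eta>. norm (y - x) < \<epsilon>}"
  using assms unfolding slice_ball_def slice_def upper_half_space_def by blast

section \<open>Differentiation in a slice\<close>

text \<open>The coordinate directions of \<open>(x\<^sub>0, \<dots>, x\<^sub>p, r)\<close>.\<close>

definition frame :: "nat \<Rightarrow> octonion \<Rightarrow> octonion set" where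
  "frame p \<eta> = e ` {..p} \<union> {\<eta>}"

definition has_partial :: "octonion \<Rightarrow> (octonion \<Rightarrow> 'b::real_normed_vector) \<Rightarrow> octonion \<Rightarrow> bool" where
  "has_partial v f y \<longleftrightarrow> (\<lambda>t::real. f (y + t *\<^sub>R v)) differentiable (at 0)"

definition partial :: "octonion \<Rightarrow> (octonion \<Rightarrow> 'b::real_normed_vector) \<Rightarrow> octonion \<Rightarrow> 'b" where
  "partial v f y = vector_derivative (\<lambda>t::real. f (y + t *\<^sub>R v)) (at 0)"

text \<open>\<open>f \<in> C\<^sup>k(W)\<close>, intended for \<open>W\<close> open in the slice.\<close>

primrec Ck_on :: "nat \<Rightarrow> octonion \<Rightarrow> nat \<Rightarrow> octonion set
    \<Rightarrow> (octonion \<Rightarrow> 'b::real_normed_vector) \<Rightarrow> bool" where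
  "Ck_on p \<eta> 0 W f \<longleftrightarrow> continuous_on W f"
| "Ck_on p \<eta> (Suc k) W f \<longleftrightarrow> continuous_on W f \<and>
     (\<forall>v\<in>frame p \<eta>. (\<forall>y\<in>W. has_partial v f y) \<and> Ck_on p \<eta> k W (partial v f))"

definition slice_D :: "nat \<Rightarrow> octonion \<Rightarrow> (octonion \<Rightarrow> octonion) \<Rightarrow> octonion \<Rightarrow> octonion" where
  "slice_D p \<eta> f y = (\<Sum>i\<le>p. e i \<odot> partial (e i) f y) + \<eta> \<odot> partial \<eta> f y"

text \<open>An open subset \<open>V\<close> of the slice has smooth boundary if near each of its boundary points it is
  the sublevel set of a \<open>C\<^sup>\<infinity>\<close> function without critical points.\<close>

definition smooth_boundary :: "nat \<Rightarrow> octonion \<Rightarrow> octonion set \<Rightarrow> bool" where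
  "smooth_boundary p \<eta> V \<longleftrightarrow>
     (\<forall>y\<in>slice_boundary p \<eta> V. \<exists>W (\<rho> :: octonion \<Rightarrow> real).
        openin (top_of_set (slice p \<eta>)) W \<and> y \<in> W \<and>
        (\<forall>k. Ck_on p \<eta> k W \<rho>) \<and>
        (\<forall>w\<in>W. \<exists>v\<in>frame p \<eta>. partial v \<rho> w \<noteq> 0) \<and>
        V \<inter> W = {w \<in> W. \<rho> w < 0})"

section \<open>Surface integrals in a slice\<close>

definition leb :: "nat \<Rightarrow> (nat \<Rightarrow> real) measure" where
  "leb p = (\<Pi>\<^sub>M i\<in>{..p}. lborel)"

text \<open>Integral over the graph \<open>r = h(z)\<close>, \<open>z \<in> T \<subseteq> \<real>\<^sup>p\<^sup>+\<^sup>1\<close>, with the classical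
  surface element \<open>dS = sqrt (1 + |grad h|\<^sup>2) dz\<close>.\<close>

definition graph_integral :: "nat \<Rightarrow> octonion \<Rightarrow> (nat \<Rightarrow> real) set
    \<Rightarrow> ((nat \<Rightarrow> real) \<Rightarrow> real) \<Rightarrow> (octonion \<Rightarrow> octonion) \<Rightarrow> octonion" where
  "graph_integral p \<eta> T h g =
     (LINT z:T|leb p. sqrt (1 + (\<Sum>i\<le>p. (deriv (\<lambda>t. h (z(i := t))) (z i))\<^sup>2)) *\<^sub>R
        g (paravec p z + h z *\<^sub>R \<eta>))"

text \<open>The boundary of \<open>slice_ball p \<eta> x \<epsilon>\<close> is the union of two open hemispheres, which are graphs
  over an open ball of \<open>\<real>\<^sup>p\<^sup>+\<^sup>1\<close>, and of an equator of surface measure zero.  For \<open>x\<close> in the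
  slice, \<open>x \<bullet> e i\<close> (\<open>i \<le> p\<close>) and \<open>x \<bullet> \<eta>\<close> are its coordinates \<open>x\<^sub>i\<close> and \<open>r\<close>.\<close>

definition sphere_integral :: "nat \<Rightarrow> octonion \<Rightarrow> octonion \<Rightarrow> real
    \<Rightarrow> (octonion \<Rightarrow> octonion) \<Rightarrow> octonion" where
  "sphere_integral p \<eta> x \<epsilon> g =
     (let q = (\<lambda>z. \<epsilon>\<^sup>2 - (\<Sum>i\<le>p. (z i - x \<bullet> e i)\<^sup>2));
          T = {z \<in> space (leb p). q z > 0}
      in graph_integral p \<eta> T (\<lambda>z. x \<bullet> \<eta> + sqrt (q z)) g
       + graph_integral p \<eta> T (\<lambda>z. x \<bullet> \<eta> - sqrt (q z)) g)"

definition surface_area :: "nat \<Rightarrow> real" where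
  "surface_area p = 2 * Gamma (1/2) ^ (p + 2) / Gamma (real (p + 2) / 2)"

end

theory Submission
  imports Defs
begin

text \<open>The classical argument says that the components of a monogenic function are harmonic.  For a
  function that is only \<open>C\<^sup>1\<close> the following version is more direct, because it needs first derivatives
  only.

  Write \<open>v\<^sub>0, \<dots>, v\<^sub>p\<^sub>+\<^sub>1\<close> for the orthonormal frame \<open>e\<^sub>0, \<dots>, e\<^sub>p, \<eta>\<close> of the slice, \<open>n\<close> for the outer unit
  normal of a sphere centred at \<open>x\<close> and \<open>\<partial>\<^sub>k\<close> for the derivative in direction \<open>v\<^sub>k\<close>.  Alternativity
  of the octonions gives \<open>cnj u (w a) + cnj w (u a) = 2 (u \<bullet> w) a\<close> (\<open>oct_cnj_mult_polarized\<close>).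
  Multiplying \<open>D f = 0\<close> by \<open>cnj n\<close> from the left and using this identity for the frame vectors, one
  finds that the radial derivative is a combination of tangential ones (\<open>radial_eq_tangential\<close>):
  \<open>\<Sum>\<^sub>k n\<^sub>k \<partial>\<^sub>k f = - 1/2 \<Sum>\<^sub>k\<^sub>,\<^sub>l cnj v\<^sub>k (v\<^sub>l (n\<^sub>k \<partial>\<^sub>l f - n\<^sub>l \<partial>\<^sub>k f))\<close>.

  The operators \<open>n\<^sub>k \<partial>\<^sub>l - n\<^sub>l \<partial>\<^sub>k\<close> are infinitesimal rotations, so they integrate to zero over every
  sphere (\<open>sum_tangential_eq_0\<close>).  Hence so does the radial derivative, and by Fubini and the
  fundamental theorem of calculus the mean of \<open>f\<close> over a sphere does not depend on its radius; for
  radius zero it is \<open>f x\<close>.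

  The spheres are handled as two graphs over the unit disc of \<open>\<real>\<^sup>p\<^sup>+\<^sup>1\<close>.  With \<open>h = sqrt (1 - |w|\<^sup>2)\<close>
  the surface element is \<open>dw / h\<close>, a finite measure of total mass \<open>\<pi>\<close> times the volume of the unit ball
  of \<open>\<real>\<^sup>p\<close>: integrating \<open>1 / h\<close> along one coordinate gives \<open>\<pi>\<close>, independently of the others
  (\<open>emeasure_hemisphere\<close>).  That the infinitesimal rotations integrate to zero is then the
  fundamental theorem of calculus along a single coordinate of the disc
  (\<open>integral_hemisphere_deriv\<close>), applied to functions that vanish on the rim.\<close>

section \<open>Left multiplication by octonions\<close>

text \<open>The index type \<open>8\<close> is the ring of integers modulo eight, so that \<open>of_nat\<close> enumerates it.\<close>

lemma UNIV_8_of_nat: "\<exists>i\<le>7. (k::8) = of_nat i"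
proof (cases k)
  case (of_int z)
  hence "k = of_nat (nat z)" "nat z \<le> 7" by auto
  thus ?thesis by blast
qed

lemma inner_e_e:
  assumes "i \<le> 7" "j \<le> 7" shows "e i \<bullet> e j = (if i = j then 1 else 0)"
proof -
  have "i \<in> {0,1,2,3,4,5,6,7}" "j \<in> {0,1,2,3,4,5,6,7}" using assms by auto
  hence "((of_nat i :: 8) = of_nat j) = (i = j)"
    by (elim insertE; simp)
  thus ?thesis by (simp add: e_def inner_axis_axis)
qed

lemma octonion_eqI:
  assumes "\<And>i. i \<le> 7 \<Longrightarrow> a \<bullet> e i = b \<bullet> e i" shows "a = b"
  unfolding vec_eq_iff
proof
  fix k :: 8
  obtain i where "i \<le> 7" "k = of_nat i" using UNIV_8_of_nat by blast
  thus "a $ k = b $ k" using assms[of i] by (simp add: e_def inner_axis)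
qed

lemma sum_7: "(\<Sum>i\<le>7. f i) = f 0 + f 1 + f 2 + f 3 + f 4 + f 5 + f 6 + (f (7::nat) :: 'a::comm_monoid_add)"
  by (simp add: numeral_eq_Suc)

lemma oct_mult_coord:
  "(a \<odot> b) \<bullet> e k = (\<Sum>i\<le>7. \<Sum>j\<le>7. (a \<bullet> e i) * (b \<bullet> e j) * (basis_mult i j \<bullet> e k))"
  by (simp add: oct_mult_def inner_sum_left)

lemma basis_mult_coord:
  assumes "i \<le> 7" "j \<le> 7" "k \<le> 7"
  shows "basis_mult i j \<bullet> e k =
    (if i = 0 then (if j = k then 1 else 0) else if j = 0 then (if i = k then 1 else 0)
     else if k = 0 then (if i = j then - 1 else 0) else eps i j k)"
proof -
  have "(\<Sum>k'=1..7. eps i j k' *\<^sub>R e k') \<bullet> e k = (\<Sum>k'=1..7. if k' = k then eps i j k' else 0)"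
    unfolding inner_sum_left using assms by (intro sum.cong) (auto simp: inner_e_e)
  also have "\<dots> = (if k = 0 then 0 else eps i j k)" using assms by (auto simp: sum.delta)
  finally have 1: "(\<Sum>k'=1..7. eps i j k' *\<^sub>R e k') \<bullet> e k = (if k = 0 then 0 else eps i j k)" .
  have 2: "eps i i k = 0" by (auto simp: eps_def fano_def)
  show ?thesis using assms unfolding basis_mult_def
    by (auto simp: inner_e_e inner_add_left inner_diff_left 1[unfolded One_nat_def] 2)
qed

text \<open>The multiplication table.  In this form every octonion identity becomes eight polynomial
  identities in real variables.\<close>

lemma oct_mult_coords:
  "(a \<odot> b) \<bullet> e 0 = (a\<bullet>e 0)*(b\<bullet>e 0) - (a\<bullet>e 1)*(b\<bullet>e 1) - (a\<bullet>e 2)*(b\<bullet>e 2) - (a\<bullet>e 3)*(b\<bullet>e 3)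
     - (a\<bullet>e 4)*(b\<bullet>e 4) - (a\<bullet>e 5)*(b\<bullet>e 5) - (a\<bullet>e 6)*(b\<bullet>e 6) - (a\<bullet>e 7)*(b\<bullet>e 7)"
  "(a \<odot> b) \<bullet> e 1 = (a\<bullet>e 0)*(b\<bullet>e 1) + (a\<bullet>e 1)*(b\<bullet>e 0) + (a\<bullet>e 2)*(b\<bullet>e 3) - (a\<bullet>e 3)*(b\<bullet>e 2)
     + (a\<bullet>e 4)*(b\<bullet>e 5) - (a\<bullet>e 5)*(b\<bullet>e 4) - (a\<bullet>e 6)*(b\<bullet>e 7) + (a\<bullet>e 7)*(b\<bullet>e 6)"
  "(a \<odot> b) \<bullet> e 2 = (a\<bullet>e 0)*(b\<bullet>e 2) - (a\<bullet>e 1)*(b\<bullet>e 3) + (a\<bullet>e 2)*(b\<bullet>e 0) + (a\<bullet>e 3)*(b\<bullet>e 1)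
     + (a\<bullet>e 4)*(b\<bullet>e 6) + (a\<bullet>e 5)*(b\<bullet>e 7) - (a\<bullet>e 6)*(b\<bullet>e 4) - (a\<bullet>e 7)*(b\<bullet>e 5)"
  "(a \<odot> b) \<bullet> e 3 = (a\<bullet>e 0)*(b\<bullet>e 3) + (a\<bullet>e 1)*(b\<bullet>e 2) - (a\<bullet>e 2)*(b\<bullet>e 1) + (a\<bullet>e 3)*(b\<bullet>e 0)
     + (a\<bullet>e 4)*(b\<bullet>e 7) - (a\<bullet>e 5)*(b\<bullet>e 6) + (a\<bullet>e 6)*(b\<bullet>e 5) - (a\<bullet>e 7)*(b\<bullet>e 4)"
  "(a \<odot> b) \<bullet> e 4 = (a\<bullet>e 0)*(b\<bullet>e 4) - (a\<bullet>e 1)*(b\<bullet>e 5) - (a\<bullet>e 2)*(b\<bullet>e 6) - (a\<bullet>e 3)*(b\<bullet>e 7)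
     + (a\<bullet>e 4)*(b\<bullet>e 0) + (a\<bullet>e 5)*(b\<bullet>e 1) + (a\<bullet>e 6)*(b\<bullet>e 2) + (a\<bullet>e 7)*(b\<bullet>e 3)"
  "(a \<odot> b) \<bullet> e 5 = (a\<bullet>e 0)*(b\<bullet>e 5) + (a\<bullet>e 1)*(b\<bullet>e 4) - (a\<bullet>e 2)*(b\<bullet>e 7) + (a\<bullet>e 3)*(b\<bullet>e 6)
     - (a\<bullet>e 4)*(b\<bullet>e 1) + (a\<bullet>e 5)*(b\<bullet>e 0) - (a\<bullet>e 6)*(b\<bullet>e 3) + (a\<bullet>e 7)*(b\<bullet>e 2)"
  "(a \<odot> b) \<bullet> e 6 = (a\<bullet>e 0)*(b\<bullet>e 6) + (a\<bullet>e 1)*(b\<bullet>e 7) + (a\<bullet>e 2)*(b\<bullet>e 4) - (a\<bullet>e 3)*(b\<bullet>e 5)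
     - (a\<bullet>e 4)*(b\<bullet>e 2) + (a\<bullet>e 5)*(b\<bullet>e 3) + (a\<bullet>e 6)*(b\<bullet>e 0) - (a\<bullet>e 7)*(b\<bullet>e 1)"
  "(a \<odot> b) \<bullet> e 7 = (a\<bullet>e 0)*(b\<bullet>e 7) - (a\<bullet>e 1)*(b\<bullet>e 6) + (a\<bullet>e 2)*(b\<bullet>e 5) + (a\<bullet>e 3)*(b\<bullet>e 4)
     - (a\<bullet>e 4)*(b\<bullet>e 3) - (a\<bullet>e 5)*(b\<bullet>e 2) + (a\<bullet>e 6)*(b\<bullet>e 1) + (a\<bullet>e 7)*(b\<bullet>e 0)"
  by (simp_all add: oct_mult_coord sum_7 basis_mult_coord eps_def fano_def del: One_nat_def)

lemma bounded_bilinear_oct_mult: "bounded_bilinear (\<odot>)"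
  unfolding bilinear_conv_bounded_bilinear[symmetric] bilinear_def
  by (intro conjI allI linearI octonion_eqI)
     (simp_all add: oct_mult_coord inner_add_left algebra_simps sum.distrib sum_distrib_left)

interpretation oct_mult: bounded_bilinear "(\<odot>)"
  by (rule bounded_bilinear_oct_mult)

definition oct_cnj :: "octonion \<Rightarrow> octonion" where
  "oct_cnj u = (2 * (u \<bullet> e 0)) *\<^sub>R e 0 - u"

lemma oct_cnj_coord:
  "i \<le> 7 \<Longrightarrow> oct_cnj u \<bullet> e i = (if i = 0 then u \<bullet> e 0 else - (u \<bullet> e i))"
  by (auto simp: oct_cnj_def inner_diff_left inner_e_e)

lemma oct_cnj_linear: "linear oct_cnj"
  by (rule linearI) (simp_all add: oct_cnj_def inner_add_left algebra_simps)

lemma inner_octonion: "u \<bullet> w = (\<Sum>i\<le>7. (u \<bullet> e i) * (w \<bullet> e i))"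
proof -
  have "w = (\<Sum>i\<le>7. (w \<bullet> e i) *\<^sub>R e i)"
  proof (rule octonion_eqI)
    fix j :: nat assume "j \<le> 7"
    have "(\<Sum>i\<le>7. (w \<bullet> e i) *\<^sub>R e i) \<bullet> e j = (\<Sum>i\<le>7. if i = j then w \<bullet> e i else 0)"
      unfolding inner_sum_left using \<open>j \<le> 7\<close> by (intro sum.cong) (auto simp: inner_e_e)
    thus "w \<bullet> e j = (\<Sum>i\<le>7. (w \<bullet> e i) *\<^sub>R e i) \<bullet> e j"
      using \<open>j \<le> 7\<close> by simp
  qed
  hence "u \<bullet> w = u \<bullet> (\<Sum>i\<le>7. (w \<bullet> e i) *\<^sub>R e i)" by simp
  also have "\<dots> = (\<Sum>i\<le>7. (u \<bullet> e i) * (w \<bullet> e i))"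
    unfolding inner_sum_right by (simp add: mult.commute)
  finally show ?thesis .
qed

text \<open>Left alternativity \<open>u (u a) = (u u) a\<close> combined with \<open>u u = 2 (u \<bullet> e 0) u - |u|\<^sup>2\<close>.  The coordinates
  of both sides are polynomials, which are compared by expansion.\<close>

lemma oct_cnj_mult_cancel: "oct_cnj u \<odot> (u \<odot> a) = (u \<bullet> u) *\<^sub>R a"
proof (rule octonion_eqI)
  fix i :: nat assume "i \<le> 7"
  hence "i \<in> {0,1,2,3,4,5,6,7}" by auto
  thus "(oct_cnj u \<odot> (u \<odot> a)) \<bullet> e i = ((u \<bullet> u) *\<^sub>R a) \<bullet> e i"
    by (elim insertE emptyE; simp only: oct_mult_coords inner_scaleR_left)
       (simp_all add: oct_mult_coords oct_cnj_coord inner_octonion[of u u] sum_7 algebra_simps)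
qed

text \<open>The Clifford relation between left multiplications; it replaces associativity, which would
  turn \<open>cnj u (w a)\<close> into \<open>(cnj u w) a\<close>.\<close>

lemma oct_cnj_mult_polarized:
  "oct_cnj u \<odot> (w \<odot> a) + oct_cnj w \<odot> (u \<odot> a) = (2 * (u \<bullet> w)) *\<^sub>R a"
  using oct_cnj_mult_cancel[of "u + w" a] oct_cnj_mult_cancel[of u a] oct_cnj_mult_cancel[of w a]
  by (simp add: linear_add[OF oct_cnj_linear] oct_mult.add_left oct_mult.add_right
      inner_add_left inner_add_right inner_commute algebra_simps)

section \<open>Differentiability in a slice\<close>

lemma has_partial_vector_derivative:
  assumes "has_partial v f (y + s *\<^sub>R v)"
  shows "((\<lambda>t. f (y + t *\<^sub>R v)) has_vector_derivative partial v f (y + s *\<^sub>R v)) (at s)"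
proof -
  let ?g = "\<lambda>t. f ((y + s *\<^sub>R v) + t *\<^sub>R v)"
  have "(?g has_vector_derivative partial v f (y + s *\<^sub>R v)) (at 0)"
    using assms unfolding has_partial_def partial_def by (simp add: vector_derivative_works)
  hence "(?g has_vector_derivative partial v f (y + s *\<^sub>R v)) (at ((\<lambda>t. t - s) s))"
    by simp
  moreover have "((\<lambda>t. t - s) has_vector_derivative 1) (at s)"
    by (auto intro!: derivative_eq_intros)
  ultimately have "(?g \<circ> (\<lambda>t. t - s) has_vector_derivative 1 *\<^sub>R partial v f (y + s *\<^sub>R v)) (at s)"
    by (intro vector_diff_chain_at)
  moreover have "?g \<circ> (\<lambda>t. t - s) = (\<lambda>t. f (y + t *\<^sub>R v))"
    by (auto simp: fun_eq_iff algebra_simps)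
  ultimately show ?thesis by simp
qed

text \<open>The usual proof that continuous partial derivatives give total differentiability, on the subspace
  spanned by finitely many orthonormal directions.  One direction is added at a time: the increment
  along the new direction is controlled by the mean value inequality, the rest by induction.  The
  induction runs over the differentiation directions \<open>S\<close>, while openness of \<open>V\<close> refers to the whole
  slice \<open>L\<close>.\<close>

lemma has_derivative_of_continuous_partials:
  fixes f :: "octonion \<Rightarrow> 'b::real_normed_vector"
  assumes orth: "\<And>v w. v \<in> F \<Longrightarrow> w \<in> F \<Longrightarrow> v \<bullet> w = (if v = w then 1 else 0)"
    and L: "subspace L" "F \<subseteq> L"
    and V: "openin (top_of_set L) V" "y \<in> V"
    and ex: "\<And>v z. v \<in> F \<Longrightarrow> z \<in> V \<Longrightarrow> has_partial v f z"
    and cont: "\<And>v. v \<in> F \<Longrightarrow> continuous_on V (partial v f)"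
    and S: "finite S" "S \<subseteq> F"
  shows "(f has_derivative (\<lambda>u. \<Sum>v\<in>S. (u \<bullet> v) *\<^sub>R partial v f y)) (at y within {z. z - y \<in> span S})"
  using S
proof (induction S)
  case empty
  show ?case
    unfolding has_derivative_within_alt by (auto intro!: exI[of _ 1] bounded_linear_zero)
next
  case (insert v S)
  hence vF: "v \<in> F" and SF: "S \<subseteq> F" by auto
  show ?case unfolding has_derivative_within_alt
  proof (intro conjI allI impI)
    show "bounded_linear (\<lambda>u. \<Sum>v\<in>insert v S. (u \<bullet> v) *\<^sub>R partial v f y)"
      by (intro bounded_linear_sum bounded_linear_scaleR_const bounded_linear_inner_left)
    fix r :: real assume "r > 0"
    from insert.IH[OF SF] obtain d1 where d1: "d1 > 0"
      "\<And>z. z - y \<in> span S \<Longrightarrow> norm (z - y) < d1 \<Longrightarrow>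
         norm (f z - f y - (\<Sum>v\<in>S. ((z - y) \<bullet> v) *\<^sub>R partial v f y)) \<le> (r/2) * norm (z - y)"
    proof -
      have "0 < r / 2" using \<open>r > 0\<close> by simp
      thus ?thesis
        using that insert.IH[OF SF, unfolded has_derivative_within_alt, THEN conjunct2, rule_format, of "r/2"]
        by auto
    qed
    obtain d2 where d2: "d2 > 0" "\<And>z. z \<in> L \<Longrightarrow> dist z y < d2 \<Longrightarrow> z \<in> V"
      using V unfolding openin_euclidean_subtopology_iff by blast
    obtain d3 where d3: "d3 > 0"
      "\<And>z. z \<in> V \<Longrightarrow> dist z y < d3 \<Longrightarrow> dist (partial v f z) (partial v f y) < r/2"
      using cont[OF vF] V(2) \<open>r > 0\<close> unfolding continuous_on_iff by (meson half_gt_zero)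
    have yL: "y \<in> L" using V unfolding openin_euclidean_subtopology_iff by blast
    have spanL: "span S \<subseteq> L" using SF L by (meson order_trans span_minimal)
    define d where "d = min d1 (min d2 d3)"
    have "norm (f z - f y - (\<Sum>v\<in>insert v S. ((z - y) \<bullet> v) *\<^sub>R partial v f y)) \<le> r * norm (z - y)"
      if z: "z - y \<in> span (insert v S)" "norm (z - y) < d" for z
    proof -
      obtain t where t: "z - y - t *\<^sub>R v \<in> span S" using z(1) by (auto simp: span_breakdown_eq)
      define u where "u = z - y - t *\<^sub>R v"
      have ort: "orthogonal v u"
        using t unfolding u_def[symmetric]
        by (rule orthogonal_to_span) (use insert.hyps vF SF orth in \<open>auto simp: orthogonal_def\<close>)
      have nv: "norm v = 1" using orth[OF vF vF] by (simp add: norm_eq_1)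
      have nrm: "norm (u + \<tau> *\<^sub>R v) \<le> norm (z - y)" if "\<bar>\<tau>\<bar> \<le> \<bar>t\<bar>" for \<tau>
      proof -
        have n: "(norm (u + c *\<^sub>R v))\<^sup>2 = (norm u)\<^sup>2 + c\<^sup>2" for c
          using ort nv by (simp add: norm_add_Pythagorean orthogonal_def inner_commute)
        have "z - y = u + t *\<^sub>R v" by (simp add: u_def)
        hence "(norm (u + \<tau> *\<^sub>R v))\<^sup>2 \<le> (norm (z - y))\<^sup>2"
          using n[of \<tau>] n[of t] that by (simp add: abs_le_square_iff)
        thus ?thesis by (simp add: power2_le_iff_abs_le)
      qed
      have mem: "y + u + \<tau> *\<^sub>R v \<in> V" "dist (y + u + \<tau> *\<^sub>R v) y < d" if "\<bar>\<tau>\<bar> \<le> \<bar>t\<bar>" for \<tau>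
      proof -
        show 1: "dist (y + u + \<tau> *\<^sub>R v) y < d"
          using nrm[OF that] z(2) by (simp add: dist_norm algebra_simps)
        have "y + u + \<tau> *\<^sub>R v \<in> L"
          using t spanL yL vF L by (auto simp: u_def[symmetric] intro!: subspace_add subspace_scale)
        thus "y + u + \<tau> *\<^sub>R v \<in> V" using d2 1 by (simp add: d_def)
      qed
      define \<phi> where "\<phi> = (\<lambda>\<tau>. f (y + u + \<tau> *\<^sub>R v) - \<tau> *\<^sub>R partial v f y)"
      have A: "norm (\<phi> t - \<phi> 0) \<le> (r/2) * norm (t - 0)"
      proof (rule differentiable_bound)
        show "convex (cball (0::real) \<bar>t\<bar>)" by simp
        fix \<tau> :: real assume "\<tau> \<in> cball 0 \<bar>t\<bar>"
        hence \<tau>: "\<bar>\<tau>\<bar> \<le> \<bar>t\<bar>" by simp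
        let ?D = "partial v f (y + u + \<tau> *\<^sub>R v) - partial v f y"
        have "(\<phi> has_vector_derivative ?D) (at \<tau>)"
          unfolding \<phi>_def
          by (rule derivative_eq_intros has_partial_vector_derivative ex vF mem \<tau> refl | simp)+
        thus "(\<phi> has_derivative (\<lambda>x. x *\<^sub>R ?D)) (at \<tau> within cball 0 \<bar>t\<bar>)"
          by (simp add: has_vector_derivative_def has_derivative_at_withinI)
        have "norm ?D \<le> r/2" using d3(2)[OF mem(1)] mem(2) \<tau> by (force simp: d_def dist_norm)
        thus "onorm (\<lambda>x. x *\<^sub>R ?D) \<le> r/2"
          using mult_left_mono[of "norm ?D" "r/2" "\<bar>_\<bar>"]
          by (intro onorm_le) (simp add: mult.commute)
      qed auto
      have B: "norm (f (y + u) - f y - (\<Sum>v\<in>S. (u \<bullet> v) *\<^sub>R partial v f y)) \<le> (r/2) * norm u"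
        using d1(2)[of "y + u"] t nrm[of 0] z(2) by (simp add: u_def[symmetric] d_def)
      have zv: "(z - y) \<bullet> v = t"
      proof -
        have "z - y = u + t *\<^sub>R v" by (simp add: u_def)
        moreover have "u \<bullet> v = 0" using ort by (simp add: orthogonal_def inner_commute)
        ultimately show ?thesis using orth[OF vF vF] by (simp add: inner_add_left)
      qed
      have C: "f z - f y - (\<Sum>v\<in>insert v S. ((z - y) \<bullet> v) *\<^sub>R partial v f y) =
        (\<phi> t - \<phi> 0) + (f (y + u) - f y - (\<Sum>v\<in>S. (u \<bullet> v) *\<^sub>R partial v f y))"
      proof -
        have zy: "z = y + u + t *\<^sub>R v" by (simp add: u_def)
        have "(z - y) \<bullet> w = u \<bullet> w" if "w \<in> S" for w
        proof -
          have "v \<noteq> w" "w \<in> F" using that insert.hyps SF by auto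
          thus ?thesis using orth[OF vF, of w] by (simp add: zy inner_add_left)
        qed
        hence "(\<Sum>w\<in>S. ((z - y) \<bullet> w) *\<^sub>R partial w f y) = (\<Sum>w\<in>S. (u \<bullet> w) *\<^sub>R partial w f y)"
          by (intro sum.cong) auto
        thus ?thesis using insert.hyps zv by (simp add: \<phi>_def zy[symmetric])
      qed
      have D: "norm u \<le> norm (z - y)" using nrm[of 0] by simp
      have E: "\<bar>t\<bar> \<le> norm (z - y)"
        using Cauchy_Schwarz_ineq2[of "z - y" v] nv zv by simp
      have "norm (f z - f y - (\<Sum>v\<in>insert v S. ((z - y) \<bullet> v) *\<^sub>R partial v f y))
          \<le> (r/2) * \<bar>t\<bar> + (r/2) * norm u"
        unfolding C using A B by (intro norm_triangle_mono) auto
      also have "\<dots> \<le> (r/2) * norm (z - y) + (r/2) * norm (z - y)"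
        using D E \<open>r > 0\<close> by (intro add_mono mult_left_mono) auto
      finally show ?thesis by simp
    qed
    moreover have "d > 0" using d1 d2 d3 by (simp add: d_def)
    ultimately show "\<exists>d>0. \<forall>z\<in>{z. z - y \<in> span (insert v S)}. norm (z - y) < d \<longrightarrow>
        norm (f z - f y - (\<Sum>v\<in>insert v S. ((z - y) \<bullet> v) *\<^sub>R partial v f y)) \<le> r * norm (z - y)"
      by auto
  qed
qed

locale slice_direction =
  fixes p :: nat and \<eta> :: octonion
  assumes p_le: "p \<le> 6" and \<eta>: "\<eta> \<in> imag_sphere p"
begin

text \<open>The frame of the slice, enumerated: \<open>\<eta>\<close> comes last, as number \<open>p + 1\<close>.\<close>

definition dir :: "nat \<Rightarrow> octonion" where
  "dir k = (if k \<le> p then e k else \<eta>)"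

lemma \<eta>_orthogonal: "i \<le> p \<Longrightarrow> \<eta> \<bullet> e i = 0"
proof -
  assume i: "i \<le> p"
  obtain c where c: "\<eta> = (\<Sum>i=p+1..7. c i *\<^sub>R e i)" using \<eta> unfolding imag_sphere_def by blast
  show ?thesis unfolding c inner_sum_left
    by (intro sum.neutral) (use i p_le in \<open>auto simp: inner_e_e\<close>)
qed

lemma \<eta>_unit: "\<eta> \<bullet> \<eta> = 1"
proof -
  obtain c where c: "\<eta> = (\<Sum>i=p+1..7. c i *\<^sub>R e i)" "(\<Sum>i=p+1..7. (c i)\<^sup>2) = 1"
    using \<eta> unfolding imag_sphere_def by blast
  have "\<eta> \<bullet> \<eta> = (\<Sum>i=p+1..7. \<Sum>j=p+1..7. if j = i then c i * c j else 0)"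
    unfolding c(1) inner_sum_left inner_sum_right
    by (intro sum.cong refl) (auto simp: inner_e_e)
  also have "\<dots> = (\<Sum>i=p+1..7. (c i)\<^sup>2)"
    by (intro sum.cong refl) (simp add: power2_eq_square)
  finally show ?thesis using c by simp
qed

lemma inner_dir: "k \<le> Suc p \<Longrightarrow> l \<le> Suc p \<Longrightarrow> dir k \<bullet> dir l = (if k = l then 1 else 0)"
  using p_le by (auto simp: dir_def \<eta>_orthogonal \<eta>_unit inner_e_e inner_commute[of "e _" \<eta>])

lemma inj_dir: "inj_on dir {..Suc p}"
  by (rule inj_onI) (metis inner_dir atMost_iff zero_neq_one)

lemma frame_eq_dir: "frame p \<eta> = dir ` {..Suc p}"
proof -
  have "dir ` {..p} = e ` {..p}" by (intro image_cong) (auto simp: dir_def)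
  thus ?thesis unfolding frame_def atMost_Suc by (auto simp: dir_def)
qed

lemma paravec_inner_\<eta>: "paravec p z \<bullet> \<eta> = 0"
  unfolding paravec_def inner_sum_left by (simp add: \<eta>_orthogonal inner_commute[of "e _" \<eta>])

lemma paravec_inner_e: "i \<le> p \<Longrightarrow> paravec p z \<bullet> e i = z i"
proof -
  assume i: "i \<le> p"
  have "paravec p z \<bullet> e i = (\<Sum>k\<le>p. if k = i then z k else 0)"
    unfolding paravec_def inner_sum_left
    by (intro sum.cong refl) (use i p_le in \<open>auto simp: inner_e_e\<close>)
  thus ?thesis using i by simp
qed

lemma norm_slice_point: "(norm (paravec p z + r *\<^sub>R \<eta>))\<^sup>2 = (\<Sum>i\<le>p. (z i)\<^sup>2) + r\<^sup>2"
proof -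
  have "paravec p z \<bullet> paravec p z = (\<Sum>i\<le>p. (z i)\<^sup>2)"
  proof -
    have "paravec p z \<bullet> (\<Sum>i\<le>p. z i *\<^sub>R e i) = (\<Sum>i\<le>p. (z i)\<^sup>2)"
      unfolding inner_sum_right inner_scaleR_right
      by (intro sum.cong refl) (simp add: paravec_inner_e power2_eq_square)
    thus ?thesis by (simp flip: paravec_def)
  qed
  thus ?thesis unfolding power2_norm_eq_inner
    by (simp add: inner_add_left inner_add_right paravec_inner_\<eta> \<eta>_unit inner_commute[of \<eta> "paravec _ _"]
        power2_eq_square)
qed

text \<open>This makes the slice available as a linear subspace.\<close>

lemma slice_eq_span: "slice p \<eta> = span (frame p \<eta>)"
proof
  have "e i \<in> span (frame p \<eta>)" if "i \<le> p" for i
    by (rule span_base) (use that in \<open>auto simp: frame_def\<close>)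
  thus "slice p \<eta> \<subseteq> span (frame p \<eta>)"
    by (auto simp: slice_def paravec_def frame_def
        intro!: span_add span_sum span_scale span_base[of \<eta>])
  have "subspace (slice p \<eta>)"
  proof (rule subspaceI)
    have "0 = paravec p (\<lambda>_. 0) + 0 *\<^sub>R \<eta>" by (simp add: paravec_def)
    thus "0 \<in> slice p \<eta>" unfolding slice_def by blast
    fix a b assume "a \<in> slice p \<eta>" "b \<in> slice p \<eta>"
    then obtain z r z' r' where "a = paravec p z + r *\<^sub>R \<eta>" "b = paravec p z' + r' *\<^sub>R \<eta>"
      unfolding slice_def by blast
    hence "a + b = paravec p (\<lambda>i. z i + z' i) + (r + r') *\<^sub>R \<eta>"
      by (simp add: paravec_def sum.distrib algebra_simps)
    thus "a + b \<in> slice p \<eta>" unfolding slice_def by blast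
  next
    fix a c assume "a \<in> slice p \<eta>"
    then obtain z r where "a = paravec p z + r *\<^sub>R \<eta>" unfolding slice_def by blast
    hence "c *\<^sub>R a = paravec p (\<lambda>i. c * z i) + (c * r) *\<^sub>R \<eta>"
      by (simp add: paravec_def scaleR_sum_right algebra_simps)
    thus "c *\<^sub>R a \<in> slice p \<eta>" unfolding slice_def by blast
  qed
  moreover have "frame p \<eta> \<subseteq> slice p \<eta>"
  proof -
    have "e i = paravec p (\<lambda>k. if k = i then 1 else 0) + 0 *\<^sub>R \<eta>" if "i \<le> p" for i
      using that unfolding paravec_def by (simp add: if_distrib[of "\<lambda>x. x *\<^sub>R _"] cong: if_cong)
    moreover have "\<eta> = paravec p (\<lambda>_. 0) + 1 *\<^sub>R \<eta>" by (simp add: paravec_def)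
    ultimately show ?thesis unfolding frame_def slice_def by blast
  qed
  ultimately show "span (frame p \<eta>) \<subseteq> slice p \<eta>" by (rule span_minimal[rotated])
qed

lemma slice_point_mem: "paravec p z + r *\<^sub>R \<eta> \<in> slice p \<eta>"
  unfolding slice_def by blast

lemma subspace_slice: "subspace (slice p \<eta>)"
  unfolding slice_eq_span by (rule subspace_span)

lemma slice_point_coords:
  assumes "x \<in> slice p \<eta>" shows "x = paravec p (\<lambda>i. x \<bullet> e i) + (x \<bullet> \<eta>) *\<^sub>R \<eta>"
proof -
  obtain z r where x: "x = paravec p z + r *\<^sub>R \<eta>" using assms unfolding slice_def by blast
  have "x \<bullet> \<eta> = r" by (simp add: x inner_add_left paravec_inner_\<eta> \<eta>_unit)
  moreover have "x \<bullet> e i = z i" if "i \<le> p" for i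
    using that by (simp add: x inner_add_left paravec_inner_e \<eta>_orthogonal)
  hence "paravec p (\<lambda>i. x \<bullet> e i) = paravec p z" by (simp add: paravec_def)
  ultimately show ?thesis by (simp add: x)
qed

lemma slice_chain_rule:
  fixes f :: "octonion \<Rightarrow> 'b::real_normed_vector"
  assumes V: "openin (top_of_set (slice p \<eta>)) V" and C1: "Ck_on p \<eta> 1 V f"
    and \<gamma>: "(\<gamma> has_vector_derivative \<gamma>') (at t)" "\<And>s. \<gamma> s \<in> slice p \<eta>" "\<gamma> t \<in> V"
  shows "((\<lambda>s. f (\<gamma> s)) has_vector_derivative
           (\<Sum>k\<le>Suc p. (\<gamma>' \<bullet> dir k) *\<^sub>R partial (dir k) f (\<gamma> t))) (at t)"
proof -
  have "(f has_derivative (\<lambda>u. \<Sum>v\<in>frame p \<eta>. (u \<bullet> v) *\<^sub>R partial v f (\<gamma> t)))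
          (at (\<gamma> t) within {z. z - \<gamma> t \<in> span (frame p \<eta>)})"
  proof (rule has_derivative_of_continuous_partials[OF _ subspace_slice _ V \<gamma>(3)])
    show "v \<bullet> w = (if v = w then 1 else 0)" if "v \<in> frame p \<eta>" "w \<in> frame p \<eta>" for v w
      using that inner_dir inj_onD[OF inj_dir] unfolding frame_eq_dir by auto
    show "frame p \<eta> \<subseteq> slice p \<eta>" unfolding slice_eq_span by (rule span_superset)
    show "finite (frame p \<eta>)" by (simp add: frame_eq_dir)
  qed (use C1 in auto)
  moreover have "{z. z - \<gamma> t \<in> span (frame p \<eta>)} \<supseteq> range \<gamma>"
    using \<gamma>(2) subspace_diff[OF subspace_slice] by (auto simp: slice_eq_span)
  ultimately have "(f has_derivative (\<lambda>u. \<Sum>v\<in>frame p \<eta>. (u \<bullet> v) *\<^sub>R partial v f (\<gamma> t)))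
          (at (\<gamma> t) within range \<gamma>)"
    by (rule has_derivative_subset)
  from vector_derivative_diff_chain_within[OF \<gamma>(1) this]
  have "((f \<circ> \<gamma>) has_vector_derivative (\<Sum>v\<in>frame p \<eta>. (\<gamma>' \<bullet> v) *\<^sub>R partial v f (\<gamma> t))) (at t)" .
  thus ?thesis unfolding frame_eq_dir by (simp add: sum.reindex[OF inj_dir] o_def del: sum.atMost_Suc)
qed

end

section \<open>The surface measure of a hemisphere\<close>

abbreviation euclid :: "'i set \<Rightarrow> ('i \<Rightarrow> real) measure" where
  "euclid I \<equiv> Pi\<^sub>M I (\<lambda>_. lborel)"

interpretation euclid: product_sigma_finite "\<lambda>_::'i. lborel :: real measure"
  by standard

text \<open>Substitution \<open>z = c + s w\<close>, proved on boxes, where it reduces to dimension one.\<close>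

lemma integral_euclid_affine:
  fixes g :: "('i \<Rightarrow> real) \<Rightarrow> 'b::{banach, second_countable_topology}"
  assumes I: "finite I" and s: "s > 0" and g[measurable]: "g \<in> borel_measurable (euclid I)"
  shows "integral\<^sup>L (euclid I) g =
    s ^ card I *\<^sub>R (\<integral>w. g (\<lambda>i\<in>I. c i + s * w i) \<partial>euclid I)"
proof -
  let ?T = "\<lambda>w. \<lambda>i\<in>I. c i + s * w i"
  have T[measurable]: "?T \<in> measurable (euclid I) (euclid I)"
    by measurable
  have one: "ennreal s * emeasure lborel ((\<lambda>t. c i + s * t) -` A) = emeasure lborel A"
    if [measurable]: "A \<in> sets lborel" for i and A :: "real set"
  proof -
    have "emeasure lborel A = emeasure (density (distr lborel borel (\<lambda>t. c i + s * t)) (\<lambda>_. ennreal (abs s))) A"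
      using s lborel_real_affine[of s "c i"] by simp
    also have "\<dots> = ennreal s * emeasure lborel ((\<lambda>t. c i + s * t) -` A)"
      using s that by (simp add: emeasure_density nn_integral_cmult_indicator emeasure_distr mult.commute)
    finally show ?thesis ..
  qed
  have "density (distr (euclid I) (euclid I) ?T) (\<lambda>_. ennreal (s ^ card I)) = euclid I"
  proof (rule euclid.PiM_eqI[OF I])
    fix A :: "'i \<Rightarrow> real set" assume A: "\<And>i. i \<in> I \<Longrightarrow> A i \<in> sets lborel"
    have AS: "Pi\<^sub>E I A \<in> sets (euclid I)" using A I by (intro sets_PiM_I_finite)
    have vi: "(\<lambda>t. c i + s * t) -` A i \<in> sets lborel" if "i \<in> I" for i
      using measurable_sets[of "\<lambda>t. c i + s * t" lborel lborel "A i"] A[OF that] by simp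
    have pre: "?T -` Pi\<^sub>E I A \<inter> space (euclid I) = (\<Pi>\<^sub>E i\<in>I. (\<lambda>t. c i + s * t) -` A i)"
      by (auto simp: space_PiM PiE_def Pi_def extensional_def)
    have "emeasure (density (distr (euclid I) (euclid I) ?T) (\<lambda>_. ennreal (s ^ card I))) (Pi\<^sub>E I A)
        = ennreal (s ^ card I) * emeasure (euclid I) (\<Pi>\<^sub>E i\<in>I. (\<lambda>t. c i + s * t) -` A i)"
      using AS by (simp add: emeasure_density nn_integral_cmult_indicator emeasure_distr pre mult.commute)
    also have "\<dots> = (\<Prod>i\<in>I. ennreal s) * (\<Prod>i\<in>I. emeasure lborel ((\<lambda>t. c i + s * t) -` A i))"
      using I vi s by (subst euclid.emeasure_PiM) (auto simp: ennreal_power)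
    also have "\<dots> = (\<Prod>i\<in>I. emeasure lborel (A i))"
      unfolding prod.distrib[symmetric] by (intro prod.cong refl one A)
    finally show "emeasure (density (distr (euclid I) (euclid I) ?T) (\<lambda>_. ennreal (s ^ card I))) (Pi\<^sub>E I A)
        = (\<Prod>i\<in>I. emeasure lborel (A i))" .
  qed simp
  hence "integral\<^sup>L (euclid I) g =
      integral\<^sup>L (density (distr (euclid I) (euclid I) ?T) (\<lambda>_. ennreal (s ^ card I))) g"
    by simp
  also have "\<dots> = s ^ card I *\<^sub>R (\<integral>w. g (?T w) \<partial>euclid I)"
    using s by (subst integral_density) (auto simp: integral_distr)
  finally show ?thesis .
qed

definition unit_disc :: "'i set \<Rightarrow> ('i \<Rightarrow> real) set" where
  "unit_disc I = {w \<in> space (euclid I). (\<Sum>i\<in>I. (w i)\<^sup>2) < 1}"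

definition height :: "'i set \<Rightarrow> ('i \<Rightarrow> real) \<Rightarrow> real" where
  "height I w = sqrt (1 - (\<Sum>i\<in>I. (w i)\<^sup>2))"

text \<open>The surface measure of a unit hemisphere of dimension \<open>card I\<close>, transported to the disc below it:
  the graph of \<open>h = height I\<close> has surface element \<open>sqrt (1 + |grad h|\<^sup>2) dw = dw / h\<close>.\<close>

definition hemisphere :: "'i set \<Rightarrow> ('i \<Rightarrow> real) measure" where
  "hemisphere I = density (euclid I) (\<lambda>w. ennreal (indicator (unit_disc I) w / height I w))"

lemma height_measurable [measurable]: "finite I \<Longrightarrow> height I \<in> borel_measurable (euclid I)"
  unfolding height_def by measurable

lemma unit_disc_measurable [measurable]: "finite I \<Longrightarrow> unit_disc I \<in> sets (euclid I)"
  unfolding unit_disc_def by measurable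

lemma height_pos: "w \<in> unit_disc I \<Longrightarrow> height I w > 0"
  by (simp add: unit_disc_def height_def)

lemma height_le_1: "height I w \<le> 1"
  by (simp add: height_def sum_nonneg)

lemma sets_hemisphere [measurable_cong, simp]: "sets (hemisphere I) = sets (euclid I)"
  by (simp add: hemisphere_def)

lemma AE_hemisphere:
  assumes "finite I" "\<And>w. w \<in> unit_disc I \<Longrightarrow> P w"
  shows "AE w in hemisphere I. P w"
proof -
  have "AE w in hemisphere I. w \<in> unit_disc I"
    unfolding hemisphere_def
    by (subst AE_density) (use assms in \<open>auto split: split_indicator\<close>)
  thus ?thesis by eventually_elim (rule assms)
qed

text \<open>The value does not depend on \<open>b\<close>: this is why the mass of a hemisphere is \<open>\<pi>\<close> times the volume of
  a ball of one dimension less.\<close>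

lemma nn_integral_arcsine:
  fixes b :: real
  assumes "b > 0"
  shows "(\<integral>\<^sup>+t. ennreal (indicator {t. t\<^sup>2 < b} t / sqrt (b - t\<^sup>2)) \<partial>lborel) = ennreal pi"
proof -
  define a where "a = sqrt b"
  have a: "a > 0" "b = a\<^sup>2" using assms by (auto simp: a_def)
  have lim: "t\<^sup>2 < b \<longleftrightarrow> -a < t \<and> t < a" for t
    using a(1) unfolding a(2) by (metis abs_less_iff abs_of_pos minus_less_iff power2_less_imp_less real_sqrt_abs real_sqrt_less_iff)
  have deriv: "DERIV (\<lambda>t. arcsin (t / a)) t :> 1 / sqrt (b - t\<^sup>2)" if "-a < t" "t < a" for t
  proof -
    have "- 1 < t / a" "t / a < 1" using that a by (auto simp: field_simps)
    hence "DERIV (\<lambda>t. arcsin (t / a)) t :> inverse (sqrt (1 - (t / a)\<^sup>2)) * (1 / a)"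
      using a by (auto intro!: derivative_eq_intros)
    moreover have "1 - (t / a)\<^sup>2 = (b - t\<^sup>2) / a\<^sup>2" using a by (simp add: field_simps)
    hence "inverse (sqrt (1 - (t / a)\<^sup>2)) * (1 / a) = 1 / sqrt (b - t\<^sup>2)"
      using a by (simp add: real_sqrt_divide field_simps)
    ultimately show ?thesis by simp
  qed
  have cont: "isCont (\<lambda>t. 1 / sqrt (b - t\<^sup>2)) t" if "-a < t" "t < a" for t
    using lim[of t] that by (auto intro!: continuous_intros)
  have "continuous_on {-a..a} (\<lambda>t. arcsin (t / a))"
    using a by (intro continuous_intros) (auto simp: field_simps)
  hence ends: "((\<lambda>t. arcsin (t / a)) \<longlongrightarrow> - (pi/2)) (at_right (-a))"
    "((\<lambda>t. arcsin (t / a)) \<longlongrightarrow> pi/2) (at_left a)"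
    using continuous_on_Icc_at_rightD[of "-a" a "\<lambda>t. arcsin (t / a)"]
      continuous_on_Icc_at_leftD[of "-a" a "\<lambda>t. arcsin (t / a)"] a by auto
  have nn: "AE t in lborel. ereal (-a) < ereal t \<longrightarrow> ereal t < ereal a \<longrightarrow> 0 \<le> 1 / sqrt (b - t\<^sup>2)"
  proof (rule AE_I2, intro impI)
    fix t assume "ereal (-a) < ereal t" "ereal t < ereal a"
    hence "t\<^sup>2 < b" using lim by simp
    thus "0 \<le> 1 / sqrt (b - t\<^sup>2)" by simp
  qed
  have FTC: "set_integrable lborel (einterval (-a) a) (\<lambda>t. 1 / sqrt (b - t\<^sup>2))"
    "(LBINT t=ereal (-a)..ereal a. 1 / sqrt (b - t\<^sup>2)) = pi/2 - (- (pi/2))"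
    using interval_integral_FTC_nonneg[of "ereal (-a)" "ereal a" "\<lambda>t. arcsin (t / a)" "\<lambda>t. 1 / sqrt (b - t\<^sup>2)"
        "- (pi/2)" "pi/2"] deriv cont nn ends a
    by (auto simp: ereal_tendsto_simps)
  have "(\<integral>\<^sup>+t. ennreal (indicator {t. t\<^sup>2 < b} t / sqrt (b - t\<^sup>2)) \<partial>lborel) =
      (\<integral>\<^sup>+t. ennreal (indicator (einterval (-a) a) t *\<^sub>R (1 / sqrt (b - t\<^sup>2))) \<partial>lborel)"
    by (intro nn_integral_cong) (auto simp: einterval_def lim indicator_def)
  also have "\<dots> = ennreal (LBINT t=ereal (-a)..ereal a. 1 / sqrt (b - t\<^sup>2))"
    unfolding interval_lebesgue_integral_def set_lebesgue_integral_def using a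
    by (subst nn_integral_eq_integral)
       (use FTC(1) lim in \<open>auto simp: set_integrable_def einterval_def indicator_def less_imp_le intro!: AE_I2\<close>)
  finally show ?thesis using FTC(2) by simp
qed

text \<open>The volume of closed balls is known; the open disc is squeezed between closed balls of radius
  \<open>r < 1\<close> and \<open>1\<close>.\<close>

lemma emeasure_unit_disc:
  assumes I: "finite I"
  shows "emeasure (euclid I) (unit_disc I) = ennreal (unit_ball_vol (card I))"
proof -
  let ?C = "\<lambda>r. {w. sqrt (\<Sum>i\<in>I. (w i)\<^sup>2) \<le> r} \<inter> space (euclid I)"
  let ?V = "unit_ball_vol (card I)"
  have C: "?C r \<in> sets (euclid I)" for r using I by measurable
  have "emeasure (euclid I) (unit_disc I) \<le> emeasure (euclid I) (?C 1)"
    using I by (intro emeasure_mono C) (auto simp: unit_disc_def)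
  hence le: "emeasure (euclid I) (unit_disc I) \<le> ennreal ?V"
    using emeasure_cball_aux[OF I, of 1] by simp
  define r where "r = (\<lambda>n::nat. 1 - 1 / real (n + 2))"
  have r: "0 < r n" "r n < 1" for n by (auto simp: r_def)
  have "ennreal (?V * r n ^ card I) \<le> emeasure (euclid I) (unit_disc I)" for n
  proof -
    have "?C (r n) \<subseteq> unit_disc I"
    proof
      fix w assume w: "w \<in> ?C (r n)"
      hence "sqrt (\<Sum>i\<in>I. (w i)\<^sup>2) < 1" using r(2)[of n] by (simp only: Int_iff mem_Collect_eq) linarith
      thus "w \<in> unit_disc I" using w by (simp add: unit_disc_def)
    qed
    thus ?thesis using emeasure_cball_aux[OF I r(1)[of n]] emeasure_mono[OF _ unit_disc_measurable[OF I]]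
      by metis
  qed
  moreover have "(\<lambda>n. ennreal (?V * r n ^ card I)) \<longlonglongrightarrow> ennreal (?V * (1 - 0) ^ card I)"
    unfolding r_def
    by (intro tendsto_intros tendsto_ennrealI) (use LIMSEQ_ignore_initial_segment[OF lim_1_over_n, of 2] in simp)
  ultimately have "ennreal ?V \<le> emeasure (euclid I) (unit_disc I)"
    by (intro LIMSEQ_le_const2) auto
  with le show ?thesis by (rule antisym)
qed

lemma unit_disc_insert:
  assumes "finite J" "i \<notin> J" "z \<in> space (euclid J)"
  shows "z(i := t) \<in> unit_disc (insert i J) \<longleftrightarrow> t\<^sup>2 < 1 - (\<Sum>k\<in>J. (z k)\<^sup>2)"
    and "height (insert i J) (z(i := t)) = sqrt (1 - (\<Sum>k\<in>J. (z k)\<^sup>2) - t\<^sup>2)"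
proof -
  have "z(i := t) \<in> space (euclid (insert i J))"
    using assms by (auto simp: space_PiM PiE_def extensional_def)
  moreover have "(\<Sum>k\<in>insert i J. ((z(i := t)) k)\<^sup>2) = t\<^sup>2 + (\<Sum>k\<in>J. (z k)\<^sup>2)"
  proof -
    have "(\<Sum>k\<in>J. ((z(i := t)) k)\<^sup>2) = (\<Sum>k\<in>J. (z k)\<^sup>2)"
      using assms by (intro sum.cong) auto
    thus ?thesis using assms by simp
  qed
  ultimately show "z(i := t) \<in> unit_disc (insert i J) \<longleftrightarrow> t\<^sup>2 < 1 - (\<Sum>k\<in>J. (z k)\<^sup>2)"
     "height (insert i J) (z(i := t)) = sqrt (1 - (\<Sum>k\<in>J. (z k)\<^sup>2) - t\<^sup>2)"
    unfolding unit_disc_def height_def by (auto simp: algebra_simps)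
qed

text \<open>The total mass version of Archimedes' hat-box theorem: projecting away the coordinate \<open>i\<close> as well
  turns the surface measure into \<open>\<pi>\<close> times Lebesgue measure on the disc of one dimension less.\<close>

lemma emeasure_hemisphere:
  assumes J: "finite J" "i \<notin> J"
  shows "emeasure (hemisphere (insert i J)) (space (hemisphere (insert i J))) =
    ennreal (pi * unit_ball_vol (card J))"
proof -
  let ?I = "insert i J"
  have [measurable]: "unit_disc J \<in> sets (euclid J)" using J by simp
  have [measurable]: "height ?I \<in> borel_measurable (euclid ?I)" "unit_disc ?I \<in> sets (euclid ?I)"
    using J by auto
  have [measurable]: "(\<lambda>w. ennreal (indicator (unit_disc ?I) w / height ?I w)) \<in> borel_measurable (euclid ?I)"
    by measurable
  have "emeasure (hemisphere ?I) (space (hemisphere ?I)) =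
      (\<integral>\<^sup>+w. ennreal (indicator (unit_disc ?I) w / height ?I w) \<partial>euclid ?I)"
    unfolding hemisphere_def
    by (subst emeasure_density) (auto intro!: nn_integral_cong split: split_indicator)
  also have "\<dots> = (\<integral>\<^sup>+z. \<integral>\<^sup>+t. ennreal (indicator (unit_disc ?I) (z(i := t)) / height ?I (z(i := t)))
      \<partial>lborel \<partial>euclid J)"
    using J by (intro euclid.product_nn_integral_insert) auto
  also have "\<dots> = (\<integral>\<^sup>+z. ennreal pi * indicator (unit_disc J) z \<partial>euclid J)"
  proof (intro nn_integral_cong)
    fix z assume z: "z \<in> space (euclid J)"
    define b where "b = 1 - (\<Sum>k\<in>J. (z k)\<^sup>2)"
    have "(\<integral>\<^sup>+t. ennreal (indicator (unit_disc ?I) (z(i := t)) / height ?I (z(i := t))) \<partial>lborel) =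
        (\<integral>\<^sup>+t. ennreal (indicator {t. t\<^sup>2 < b} t / sqrt (b - t\<^sup>2)) \<partial>lborel)"
      by (intro nn_integral_cong) (simp add: unit_disc_insert[OF J z] b_def indicator_def)
    also have "\<dots> = ennreal pi * indicator (unit_disc J) z"
    proof (cases "b > 0")
      case True
      thus ?thesis using nn_integral_arcsine[OF True] z by (simp add: unit_disc_def b_def)
    next
      case False
      hence "\<not> t\<^sup>2 < b" for t :: real using zero_le_power2[of t] by linarith
      thus ?thesis using False z by (simp add: unit_disc_def b_def)
    qed
    finally show "(\<integral>\<^sup>+t. ennreal (indicator (unit_disc ?I) (z(i := t)) / height ?I (z(i := t))) \<partial>lborel)
      = ennreal pi * indicator (unit_disc J) z" .
  qed
  also have "\<dots> = ennreal (pi * unit_ball_vol (card J))"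
    using J by (simp add: nn_integral_cmult_indicator emeasure_unit_disc ennreal_mult')
  finally show ?thesis .
qed

lemma finite_measure_hemisphere:
  assumes "finite I" "I \<noteq> {}" shows "finite_measure (hemisphere I)"
proof
  obtain i where "i \<in> I" using assms by blast
  thus "emeasure (hemisphere I) (space (hemisphere I)) \<noteq> \<infinity>"
    using emeasure_hemisphere[of "I - {i}" i] assms by (simp add: insert_absorb)
qed

lemma integral_hemisphere:
  fixes g :: "('i \<Rightarrow> real) \<Rightarrow> 'b::{banach, second_countable_topology}"
  assumes "finite I" "g \<in> borel_measurable (euclid I)"
  shows "integral\<^sup>L (hemisphere I) g =
    (\<integral>w. (indicator (unit_disc I) w / height I w) *\<^sub>R g w \<partial>euclid I)"
  unfolding hemisphere_def using assms
  by (intro integral_density) (auto intro!: AE_I2 simp: indicator_def height_pos less_imp_le)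

text \<open>Integration along the chords of the disc in direction \<open>i\<close>: on each chord the fundamental theorem
  of calculus applies, and both end points lie on the rim, where \<open>K\<close> vanishes.  The derivative
  \<open>K'\<close> may blow up at the rim like \<open>1 / height\<close>, which happens for functions on the sphere in graph
  coordinates; therefore boundedness is asked of \<open>height * K'\<close> only, and this product, called
  \<open>G\<close>, is what is integrated against the hemisphere measure.\<close>

lemma integral_hemisphere_deriv:
  fixes K K' :: "('i \<Rightarrow> real) \<Rightarrow> 'b::euclidean_space"
  assumes I: "finite I" "i \<in> I"
    and G: "G \<in> borel_measurable (euclid I)" "\<And>w. w \<in> unit_disc I \<Longrightarrow> norm (G w) \<le> c"
      "\<And>w. w \<in> unit_disc I \<Longrightarrow> G w = height I w *\<^sub>R K' w"
    and deriv: "\<And>w. w \<in> unit_disc I \<Longrightarrow> ((\<lambda>t. K (w(i := t))) has_vector_derivative K' w) (at (w i))"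
    and cont: "\<And>w. w \<in> unit_disc I \<Longrightarrow>
      continuous_on {t. (\<Sum>k\<in>I. ((w(i := t)) k)\<^sup>2) \<le> 1} (\<lambda>t. K (w(i := t)))"
    and van: "\<And>w. (\<Sum>k\<in>I. (w k)\<^sup>2) = 1 \<Longrightarrow> K w = 0"
  shows "integral\<^sup>L (hemisphere I) G = 0"
proof -
  define J where "J = I - {i}"
  have J: "finite J" "i \<notin> J" and I_eq: "I = insert i J" using I by (auto simp: J_def)
  define H where "H = (\<lambda>w. (indicator (unit_disc I) w / height I w) *\<^sub>R G w)"
  have H: "H w = indicator (unit_disc I) w *\<^sub>R K' w" for w
    using G(3)[of w] height_pos[of w I] by (auto simp: H_def indicator_def)
  have sq: "(\<Sum>k\<in>I. ((z(i := t)) k)\<^sup>2) = t\<^sup>2 + (\<Sum>k\<in>J. (z k)\<^sup>2)" for z t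
  proof -
    have "(\<Sum>k\<in>J. ((z(i := t)) k)\<^sup>2) = (\<Sum>k\<in>J. (z k)\<^sup>2)"
      using J by (intro sum.cong) auto
    thus ?thesis using J by (simp add: I_eq)
  qed
  interpret finite_measure "hemisphere I" using finite_measure_hemisphere[of I] I by blast
  have "integrable (hemisphere I) G"
    using AE_hemisphere[OF I(1), of "\<lambda>w. norm (G w) \<le> c"] G
    by (intro integrable_const_bound[of _ c]) auto
  hence "integrable (euclid I) H"
    unfolding hemisphere_def H_def using I G
    by (subst (asm) integrable_density) (auto intro!: AE_I2 simp: indicator_def height_pos less_imp_le)
  hence int: "integrable (euclid (insert i J)) H" by (simp add: I_eq)
  have "integral\<^sup>L (hemisphere I) G = integral\<^sup>L (euclid I) H"
    unfolding H_def by (rule integral_hemisphere[OF I(1) G(1)])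
  also have "\<dots> = (\<integral>z. (\<integral>t. H (z(i := t)) \<partial>lborel) \<partial>euclid J)"
    using euclid.product_integral_insert[OF J int] by (simp add: I_eq)
  also have "\<dots> = (\<integral>z. 0 \<partial>euclid J)"
  proof (intro Bochner_Integration.integral_cong refl)
    fix z assume z: "z \<in> space (euclid J)"
    define b where "b = 1 - (\<Sum>k\<in>J. (z k)\<^sup>2)"
    note disc = unit_disc_insert[OF J z, folded I_eq b_def]
    show "(\<integral>t. H (z(i := t)) \<partial>lborel) = 0"
    proof (cases "b > 0 \<and> integrable lborel (\<lambda>t. H (z(i := t)))")
      \<comment> \<open>If the chord is empty, \<open>H\<close> vanishes on the line; if \<open>H\<close> is not integrable along it, the
        Bochner integral has the value zero by convention.\<close>
      case False
      moreover have "H (z(i := t)) = 0" if "\<not> b > 0" for t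
      proof -
        have "\<not> t\<^sup>2 < b" using that zero_le_power2[of t] by linarith
        thus ?thesis by (simp add: H disc)
      qed
      ultimately show ?thesis by (cases "b > 0") (auto simp: not_integrable_integral_eq)
    next
      case True
      define a where "a = sqrt b"
      have a: "a > 0" "b = a\<^sup>2" using True by (auto simp: a_def)
      have lt: "t\<^sup>2 < b \<longleftrightarrow> t \<in> {-a<..<a}" for t
        using a(1) unfolding a(2) by (metis abs_less_iff abs_of_pos greaterThanLessThan_iff minus_less_iff power2_less_imp_less real_sqrt_abs real_sqrt_less_iff)
      have le: "t\<^sup>2 \<le> b \<longleftrightarrow> t \<in> {-a..a}" for t
        using a(1) unfolding a(2) by (metis abs_le_iff abs_le_square_iff abs_of_pos atLeastAtMost_iff minus_le_iff)
      have Hz: "H (z(i := t)) = indicator {-a<..<a} t *\<^sub>R K' (z(i := t))" for t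
        by (simp add: H disc indicator_def lt del: greaterThanLessThan_iff)
      have "((\<lambda>t. K' (z(i := t))) has_integral (K (z(i := a)) - K (z(i := -a)))) {-a..a}"
      proof (rule fundamental_theorem_of_calculus_interior)
        have "z(i := 0) \<in> unit_disc I" using True by (simp add: disc)
        from cont[OF this] have "continuous_on {t. (\<Sum>k\<in>I. ((z(i := t)) k)\<^sup>2) \<le> 1} (\<lambda>t. K (z(i := t)))"
          by (simp only: fun_upd_upd)
        thus "continuous_on {-a..a} (\<lambda>t. K (z(i := t)))"
          by (rule continuous_on_subset) (use sq[of z] le in \<open>auto simp: b_def algebra_simps\<close>)
        fix t assume "t \<in> {-a<..<a}"
        hence "z(i := t) \<in> unit_disc I" by (simp only: disc lt)
        from deriv[OF this] show "((\<lambda>t. K (z(i := t))) has_vector_derivative K' (z(i := t))) (at t)"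
          by simp
      qed (use a in simp)
      moreover have "K (z(i := a)) = 0" "K (z(i := -a)) = 0"
        using sq[of z] a by (auto intro!: van simp: b_def)
      ultimately have "((\<lambda>t. K' (z(i := t))) has_integral 0) {-a<..<a}"
        by (simp add: has_integral_Icc_iff_Ioo)
      moreover have si: "set_integrable lborel {-a<..<a} (\<lambda>t. K' (z(i := t)))"
        using True by (simp add: set_integrable_def Hz)
      hence "(\<integral>t. H (z(i := t)) \<partial>lborel) = integral {-a<..<a} (\<lambda>t. K' (z(i := t)))"
        using set_borel_integral_eq_integral(2)[OF si] by (simp add: Hz set_lebesgue_integral_def)
      ultimately show ?thesis by (simp add: integral_unique)
    qed
  qed
  finally show ?thesis by simp
qed

lemma integrable_hemisphere:
  fixes G :: "('i \<Rightarrow> real) \<Rightarrow> 'b::{banach, second_countable_topology}"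
  assumes "finite I" "I \<noteq> {}" "G \<in> borel_measurable (euclid I)"
    and "\<And>w. w \<in> unit_disc I \<Longrightarrow> norm (G w) \<le> c"
  shows "integrable (hemisphere I) G"
proof -
  interpret finite_measure "hemisphere I" using finite_measure_hemisphere[of I] assms by blast
  show ?thesis using AE_hemisphere[OF assms(1), of "\<lambda>w. norm (G w) \<le> c"] assms
    by (intro integrable_const_bound[of _ c]) auto
qed

lemma sum_squares_upd:
  fixes w :: "'i \<Rightarrow> real"
  assumes "finite I" "k \<in> I"
  shows "(\<Sum>i\<in>I. ((w(k := t)) i)\<^sup>2) = (\<Sum>i\<in>I. (w i)\<^sup>2) - (w k)\<^sup>2 + t\<^sup>2"
proof -
  have "(\<Sum>i\<in>I - {k}. ((w(k := t)) i)\<^sup>2) = (\<Sum>i\<in>I - {k}. (w i)\<^sup>2)" by (intro sum.cong) auto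
  thus ?thesis using sum.remove[OF assms, of "\<lambda>i. (w i)\<^sup>2"] sum.remove[OF assms, of "\<lambda>i. ((w(k := t)) i)\<^sup>2"]
    by simp
qed

lemma abs_coord_le_1:
  assumes "finite I" "k \<in> I" "w \<in> unit_disc I" shows "\<bar>w k\<bar> \<le> 1"
proof -
  have "(w k)\<^sup>2 \<le> (\<Sum>i\<in>I. (w i)\<^sup>2)" using assms by (intro member_le_sum) auto
  hence "(w k)\<^sup>2 \<le> 1" using assms by (simp add: unit_disc_def)
  thus ?thesis by (simp add: abs_square_le_1)
qed

lemma height_has_derivative:
  assumes "finite I" "k \<in> I" "w \<in> unit_disc I"
  shows "((\<lambda>t. height I (w(k := t))) has_real_derivative - w k / height I w) (at (w k))"
proof -
  have "(\<Sum>i\<in>I. (w i)\<^sup>2) < 1" using assms by (simp add: unit_disc_def)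
  thus ?thesis unfolding height_def sum_squares_upd[OF assms(1,2)]
    by (auto intro!: derivative_eq_intros simp: field_simps)
qed

text \<open>The sphere consists of two hemispheres.\<close>

lemma surface_area_eq: "surface_area p = 2 * (pi * unit_ball_vol p)"
proof -
  have "sqrt pi ^ p = pi powr (real p / 2)"
    by (simp add: powr_half_sqrt[symmetric] powr_powr powr_realpow[symmetric])
  moreover have "Gamma ((2 + real p) / 2) = Gamma (real p / 2 + 1)"
    by (rule arg_cong[of _ _ Gamma]) (simp add: field_simps)
  ultimately show ?thesis
    unfolding surface_area_def unit_ball_vol_def by (simp add: power_add Gamma_one_half_real mult.assoc[symmetric])
qed

section \<open>Infinitesimal rotations integrate to zero over spheres\<close>

context slice_direction
begin

text \<open>The unit sphere of the slice: \<open>\<sigma> = 1\<close> gives the upper and \<open>\<sigma> = - 1\<close> the lower hemisphere, as graphs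
  over the unit disc.  The coordinates of the point are also those of the outer normal there.\<close>

definition sphere_point :: "real \<Rightarrow> (nat \<Rightarrow> real) \<Rightarrow> octonion" where
  "sphere_point \<sigma> w = paravec p w + (\<sigma> * height {..p} w) *\<^sub>R \<eta>"

text \<open>The coordinates of \<open>sphere_point \<sigma> w\<close> in the frame \<open>dir\<close>.\<close>

definition normal :: "real \<Rightarrow> (nat \<Rightarrow> real) \<Rightarrow> nat \<Rightarrow> real" where
  "normal \<sigma> w k = (if k \<le> p then w k else \<sigma> * height {..p} w)"

lemma sphere_point_inner_dir: "k \<le> Suc p \<Longrightarrow> sphere_point \<sigma> w \<bullet> dir k = normal \<sigma> w k"
  by (simp add: sphere_point_def normal_def dir_def inner_add_left paravec_inner_e paravec_inner_\<eta>
      \<eta>_orthogonal \<eta>_unit)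

lemma sphere_point_measurable [measurable]:
  "sphere_point \<sigma> \<in> borel_measurable (euclid {..p})"
proof -
  have [measurable]: "height {..p} \<in> borel_measurable (euclid {..p})" by simp
  show ?thesis unfolding sphere_point_def paravec_def by measurable
qed

lemma normal_measurable [measurable]:
  "k \<le> Suc p \<Longrightarrow> (\<lambda>w. normal \<sigma> w k) \<in> borel_measurable (euclid {..p})"
  by (cases "k \<le> p") (auto simp: normal_def)

lemma sphere_point_mem: "sphere_point \<sigma> w \<in> slice p \<eta>"
  unfolding sphere_point_def by (rule slice_point_mem)

lemma norm_sphere_point:
  assumes "\<bar>\<sigma>\<bar> = 1" "(\<Sum>i\<le>p. (w i)\<^sup>2) \<le> 1"
  shows "norm (sphere_point \<sigma> w) = 1"
proof -
  have "\<sigma>\<^sup>2 = 1" using assms(1) by (metis abs_square_eq_1)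
  hence "(norm (sphere_point \<sigma> w))\<^sup>2 = 1"
    unfolding sphere_point_def norm_slice_point using assms(2)
    by (simp add: power_mult_distrib height_def)
  thus ?thesis by (simp add: norm_eq_sqrt_inner power2_norm_eq_inner)
qed

lemma paravec_upd: "k \<le> p \<Longrightarrow> paravec p (w(k := t)) = paravec p w + (t - w k) *\<^sub>R e k"
proof -
  assume k: "k \<le> p"
  have "(\<Sum>i\<in>{..p} - {k}. (w(k := t)) i *\<^sub>R e i) = (\<Sum>i\<in>{..p} - {k}. w i *\<^sub>R e i)"
    by (intro sum.cong) auto
  thus ?thesis using k unfolding paravec_def
    by (subst (1 2) sum.remove[of _ k]) (auto simp: algebra_simps)
qed

end

text \<open>A \<open>C\<^sup>1\<close> function on a relatively open neighbourhood of the closed ball of radius \<open>\<epsilon>\<close> in the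
  slice.\<close>

locale C1_ball = slice_direction +
  fixes V :: "octonion set" and f :: "octonion \<Rightarrow> octonion" and x :: octonion and \<epsilon> :: real
  assumes V: "openin (top_of_set (slice p \<eta>)) V" and C1: "Ck_on p \<eta> 1 V f"
    and x: "x \<in> slice p \<eta>" and \<epsilon>: "\<epsilon> > 0"
    and ball: "slice p \<eta> \<inter> cball x \<epsilon> \<subseteq> V"
begin

text \<open>Extending \<open>f\<close> and its partial derivatives by zero makes them bounded Borel functions on all
  octonions, so that measurability and integrability along the spheres need no case distinctions.\<close>

definition value_on_ball :: "octonion \<Rightarrow> octonion" where
  "value_on_ball y = indicator (slice p \<eta> \<inter> cball x \<epsilon>) y *\<^sub>R f y"

definition partial_on_ball :: "nat \<Rightarrow> octonion \<Rightarrow> octonion" where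
  "partial_on_ball k y = indicator (slice p \<eta> \<inter> cball x \<epsilon>) y *\<^sub>R partial (dir k) f y"

lemma compact_ball: "compact (slice p \<eta> \<inter> cball x \<epsilon>)"
  using closed_subspace[OF subspace_slice] by (intro closed_Int_compact) auto

lemma continuous_f: "continuous_on (slice p \<eta> \<inter> cball x \<epsilon>) f"
  using C1 ball by (auto intro: continuous_on_subset)

lemma continuous_partial: "k \<le> Suc p \<Longrightarrow> continuous_on (slice p \<eta> \<inter> cball x \<epsilon>) (partial (dir k) f)"
  using C1 ball by (auto intro: continuous_on_subset simp: frame_eq_dir)

lemma on_ball_measurable [measurable]:
  "value_on_ball \<in> borel_measurable borel"
  "k \<le> Suc p \<Longrightarrow> partial_on_ball k \<in> borel_measurable borel"
  unfolding value_on_ball_def partial_on_ball_def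
  using compact_ball continuous_f continuous_partial[of k]
  by (auto intro!: borel_measurable_continuous_on_indicator borel_compact)

lemma on_ball_bounded:
  obtains c where "c \<ge> 0" "\<And>y. norm (value_on_ball y) \<le> c"
    "\<And>k y. k \<le> Suc p \<Longrightarrow> norm (partial_on_ball k y) \<le> c"
proof -
  have *: "\<exists>c. \<forall>y. norm (indicator (slice p \<eta> \<inter> cball x \<epsilon>) y *\<^sub>R g y) \<le> c"
    if "continuous_on (slice p \<eta> \<inter> cball x \<epsilon>) g" for g :: "octonion \<Rightarrow> octonion"
  proof -
    have "bounded (g ` (slice p \<eta> \<inter> cball x \<epsilon>))"
      using compact_continuous_image[OF that compact_ball] by (rule compact_imp_bounded)
    then obtain c where "\<forall>y\<in>slice p \<eta> \<inter> cball x \<epsilon>. norm (g y) \<le> c" unfolding bounded_iff by auto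
    thus ?thesis by (intro exI[of _ "max c 0"]) (auto simp: indicator_def le_max_iff_disj)
  qed
  obtain c0 where c0: "\<And>y. norm (value_on_ball y) \<le> c0"
    unfolding value_on_ball_def using *[OF continuous_f] by blast
  have "\<forall>k\<in>{..Suc p}. \<exists>c. \<forall>y. norm (partial_on_ball k y) \<le> c"
    unfolding partial_on_ball_def using *[OF continuous_partial] by blast
  then obtain c1 where c1: "\<And>k y. k \<le> Suc p \<Longrightarrow> norm (partial_on_ball k y) \<le> c1 k"
    by (metis atMost_iff)
  have nn: "c0 \<ge> 0" "\<And>k. k \<le> Suc p \<Longrightarrow> c1 k \<ge> 0" using c0 c1 norm_ge_zero order_trans by blast+
  define c where "c = c0 + (\<Sum>k\<le>Suc p. c1 k)"
  have "c1 k \<le> c" if "k \<le> Suc p" for k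
  proof -
    have "c1 k \<le> (\<Sum>k\<le>Suc p. c1 k)" using nn that by (intro member_le_sum) auto
    thus ?thesis using nn(1) by (simp add: c_def)
  qed
  moreover have "c0 \<le> c" unfolding c_def using nn sum_nonneg[of "{..Suc p}" c1] by auto
  ultimately show ?thesis
    using c0 c1 nn(1) by (intro that[of c]) (meson order_trans)+
qed

lemma scaled_point_mem:
  assumes "\<bar>\<sigma>\<bar> = 1" "(\<Sum>i\<le>p. (w i)\<^sup>2) \<le> 1" "0 \<le> s" "s \<le> \<epsilon>"
  shows "x + s *\<^sub>R sphere_point \<sigma> w \<in> slice p \<eta> \<inter> cball x \<epsilon>"
proof -
  have "norm (s *\<^sub>R sphere_point \<sigma> w) \<le> \<epsilon>" using assms by (simp add: norm_sphere_point)
  thus ?thesis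
    using x subspace_slice sphere_point_mem
    by (auto intro!: subspace_add subspace_scale simp: dist_norm)
qed

lemma on_ball_eq:
  assumes "\<bar>\<sigma>\<bar> = 1" "(\<Sum>i\<le>p. (w i)\<^sup>2) \<le> 1" "0 \<le> s" "s \<le> \<epsilon>"
  shows "value_on_ball (x + s *\<^sub>R sphere_point \<sigma> w) = f (x + s *\<^sub>R sphere_point \<sigma> w)"
    "partial_on_ball k (x + s *\<^sub>R sphere_point \<sigma> w) = partial (dir k) f (x + s *\<^sub>R sphere_point \<sigma> w)"
  using scaled_point_mem[OF assms] by (simp_all add: value_on_ball_def partial_on_ball_def)

lemma disc_sum_le: "w \<in> unit_disc {..p} \<Longrightarrow> (\<Sum>i\<le>p. (w i)\<^sup>2) \<le> 1"
  by (simp add: unit_disc_def)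

text \<open>Moving \<open>w\<close> in direction \<open>k\<close> moves the point on the hemisphere in direction \<open>e\<^sub>k - \<sigma> (w\<^sub>k / h) \<eta>\<close>, which
  is tangential to the sphere.\<close>

lemma sphere_deriv:
  assumes \<sigma>: "\<bar>\<sigma>\<bar> = 1" and w: "w \<in> unit_disc {..p}" and s: "0 \<le> s" "s \<le> \<epsilon>" and k: "k \<le> p"
  shows "((\<lambda>t. f (x + s *\<^sub>R sphere_point \<sigma> (w(k := t)))) has_vector_derivative
    s *\<^sub>R (partial_on_ball k (x + s *\<^sub>R sphere_point \<sigma> w)
      - (\<sigma> * w k / height {..p} w) *\<^sub>R partial_on_ball (Suc p) (x + s *\<^sub>R sphere_point \<sigma> w))) (at (w k))"
proof -
  let ?\<gamma> = "\<lambda>t. x + s *\<^sub>R sphere_point \<sigma> (w(k := t))"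
  let ?v = "s *\<^sub>R (e k + (\<sigma> * (- w k / height {..p} w)) *\<^sub>R \<eta>)"
  have k': "k \<in> {..p}" using k by simp
  note d = height_has_derivative[OF finite_atMost k' w]
  have "(?\<gamma> has_vector_derivative ?v) (at (w k))"
    unfolding sphere_point_def paravec_upd[OF k]
    by (rule derivative_eq_intros d refl | simp)+
  moreover have "?\<gamma> (w k) \<in> V" using scaled_point_mem[OF \<sigma> disc_sum_le[OF w] s] ball by auto
  moreover have "?\<gamma> t \<in> slice p \<eta>" for t
    using x subspace_slice sphere_point_mem by (intro subspace_add subspace_scale) auto
  ultimately have "((\<lambda>t. f (?\<gamma> t)) has_vector_derivative
      (\<Sum>j\<le>Suc p. (?v \<bullet> dir j) *\<^sub>R partial (dir j) f (?\<gamma> (w k)))) (at (w k))"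
    by (intro slice_chain_rule[OF V C1])
  moreover have "(\<Sum>j\<le>Suc p. (?v \<bullet> dir j) *\<^sub>R partial (dir j) f (?\<gamma> (w k))) =
     s *\<^sub>R (partial (dir k) f (?\<gamma> (w k)) - (\<sigma> * w k / height {..p} w) *\<^sub>R partial (dir (Suc p)) f (?\<gamma> (w k)))"
  proof -
    have "?v \<bullet> dir j = (if j = k then s else 0)" if "j \<le> p" for j
      using that k p_le by (auto simp: dir_def inner_add_left inner_diff_left \<eta>_orthogonal inner_e_e)
    hence "(\<Sum>j\<le>p. (?v \<bullet> dir j) *\<^sub>R partial (dir j) f (?\<gamma> (w k))) =
      (\<Sum>j\<le>p. if j = k then s *\<^sub>R partial (dir j) f (?\<gamma> (w k)) else 0)"
      by (intro sum.cong) auto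
    also have "\<dots> = s *\<^sub>R partial (dir k) f (?\<gamma> (w k))" using k by simp
    finally have "(\<Sum>j\<le>p. (?v \<bullet> dir j) *\<^sub>R partial (dir j) f (?\<gamma> (w k))) = s *\<^sub>R partial (dir k) f (?\<gamma> (w k))" .
    moreover have "?v \<bullet> dir (Suc p) = - (s * (\<sigma> * w k / height {..p} w))"
      using k by (simp add: dir_def inner_add_left inner_diff_left \<eta>_unit \<eta>_orthogonal inner_commute[of "e _"])
    ultimately show ?thesis by (simp add: scaleR_diff_right)
  qed
  ultimately show ?thesis using on_ball_eq[OF \<sigma> disc_sum_le[OF w] s] by simp
qed

lemma sphere_continuous:
  assumes \<sigma>: "\<bar>\<sigma>\<bar> = 1" and s: "0 \<le> s" "s \<le> \<epsilon>" and k: "k \<le> p"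
  shows "continuous_on {t. (\<Sum>i\<le>p. ((w(k := t)) i)\<^sup>2) \<le> 1}
           (\<lambda>t. f (x + s *\<^sub>R sphere_point \<sigma> (w(k := t))))"
proof (rule continuous_on_compose2[OF continuous_f])
  have k': "k \<in> {..p}" using k by simp
  show "continuous_on {t. (\<Sum>i\<le>p. ((w(k := t)) i)\<^sup>2) \<le> 1} (\<lambda>t. x + s *\<^sub>R sphere_point \<sigma> (w(k := t)))"
    unfolding sphere_point_def paravec_upd[OF k] height_def sum_squares_upd[OF finite_atMost k']
    by (intro continuous_intros)
qed (use scaled_point_mem[OF \<sigma> _ s] in blast)

lemma on_sphere_measurable [measurable]:
  assumes "k \<le> Suc p"
  shows "(\<lambda>w. partial_on_ball k (x + s *\<^sub>R sphere_point \<sigma> w)) \<in> borel_measurable (euclid {..p})"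
    and "(\<lambda>w. value_on_ball (x + s *\<^sub>R sphere_point \<sigma> w)) \<in> borel_measurable (euclid {..p})"
  using assms by measurable

lemma abs_normal_le_1:
  assumes "\<bar>\<sigma>\<bar> = 1" "w \<in> unit_disc {..p}" shows "\<bar>normal \<sigma> w k\<bar> \<le> 1"
  using abs_coord_le_1[of "{..p}" k w] height_le_1[of "{..p}" w] height_pos[OF assms(2)] assms
  by (auto simp: normal_def abs_mult)

text \<open>The infinitesimal rotation in the plane of the directions \<open>k\<close> and \<open>l\<close>, applied to \<open>f\<close>, on the
  sphere of radius \<open>s\<close>.\<close>

definition tangential :: "real \<Rightarrow> nat \<Rightarrow> nat \<Rightarrow> real \<Rightarrow> (nat \<Rightarrow> real) \<Rightarrow> octonion" where
  "tangential s k l \<sigma> w =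
     normal \<sigma> w k *\<^sub>R partial_on_ball l (x + s *\<^sub>R sphere_point \<sigma> w)
     - normal \<sigma> w l *\<^sub>R partial_on_ball k (x + s *\<^sub>R sphere_point \<sigma> w)"

lemma tangential_measurable [measurable]:
  "k \<le> Suc p \<Longrightarrow> l \<le> Suc p \<Longrightarrow> tangential s k l \<sigma> \<in> borel_measurable (euclid {..p})"
  unfolding tangential_def by measurable

lemma tangential_bounded:
  obtains c where "\<And>s k l \<sigma> w. \<lbrakk>\<bar>\<sigma>\<bar> = 1; k \<le> Suc p; l \<le> Suc p; w \<in> unit_disc {..p}\<rbrakk>
    \<Longrightarrow> norm (tangential s k l \<sigma> w) \<le> c"
proof -
  obtain c where c: "c \<ge> 0" "\<And>k y. k \<le> Suc p \<Longrightarrow> norm (partial_on_ball k y) \<le> c"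
    using on_ball_bounded by metis
  have "norm (tangential s k l \<sigma> w) \<le> c + c"
    if "\<bar>\<sigma>\<bar> = 1" "k \<le> Suc p" "l \<le> Suc p" "w \<in> unit_disc {..p}" for s k l \<sigma> w
  proof -
    have "norm (normal \<sigma> w i *\<^sub>R partial_on_ball j y) \<le> c" if "j \<le> Suc p" for i j y
      using mult_mono[OF abs_normal_le_1[of \<sigma> w i] c(2)[OF that, of y]] c(1)
        \<open>\<bar>\<sigma>\<bar> = 1\<close> \<open>w \<in> unit_disc {..p}\<close> by simp
    thus ?thesis unfolding tangential_def
      using that by (intro order_trans[OF norm_triangle_ineq4] add_mono) auto
  qed
  thus ?thesis by (rule that)
qed

lemma tangential_integrable:
  assumes "\<bar>\<sigma>\<bar> = 1" "k \<le> Suc p" "l \<le> Suc p"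
  shows "integrable (hemisphere {..p}) (tangential s k l \<sigma>)"
proof -
  obtain c where c: "\<And>w. w \<in> unit_disc {..p} \<Longrightarrow> norm (tangential s k l \<sigma> w) \<le> c"
    using assms tangential_bounded by metis
  thus ?thesis using assms by (intro integrable_hemisphere[of _ _ c]) auto
qed

text \<open>Rotations in a plane that contains \<open>\<eta>\<close>.  On the hemisphere \<open>\<sigma>\<close> the integrand is
  \<open>- \<sigma> h / s\<close> times the derivative of \<open>f\<close> along the graph in direction \<open>k\<close>, so that the two
  hemispheres together give the derivative of the difference of the upper and the lower values of \<open>f\<close>.
  This difference vanishes on the rim, where the hemispheres meet.\<close>

lemma tangential_mixed:
  assumes s: "0 < s" "s \<le> \<epsilon>" and k: "k \<le> p"
  shows "integral\<^sup>L (hemisphere {..p}) (tangential s k (Suc p) 1)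
       + integral\<^sup>L (hemisphere {..p}) (tangential s k (Suc p) (-1)) = 0"
proof -
  let ?P = "\<lambda>\<sigma> w. x + s *\<^sub>R sphere_point \<sigma> w"
  let ?D = "\<lambda>\<sigma> w. s *\<^sub>R (partial_on_ball k (?P \<sigma> w)
      - (\<sigma> * w k / height {..p} w) *\<^sub>R partial_on_ball (Suc p) (?P \<sigma> w))"
  \<comment> \<open>The factor \<open>- s\<close> turns the sum of both integrands into \<open>h\<close> times a derivative along the disc.\<close>
  define G where "G = (\<lambda>w. (- s) *\<^sub>R (tangential s k (Suc p) 1 w + tangential s k (Suc p) (-1) w))"
  have k': "k \<in> {..p}" "k \<le> Suc p" using k by auto
  obtain c where c: "\<And>\<sigma> w. \<bar>\<sigma>\<bar> = 1 \<Longrightarrow> w \<in> unit_disc {..p} \<Longrightarrow> norm (tangential s k (Suc p) \<sigma> w) \<le> c"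
    using k' tangential_bounded by (metis order_refl)
  have "integral\<^sup>L (hemisphere {..p}) G = 0"
  proof (rule integral_hemisphere_deriv[where i = k and K = "\<lambda>w. f (?P 1 w) - f (?P (-1) w)"
        and K' = "\<lambda>w. ?D 1 w - ?D (-1) w" and c = "\<bar>s\<bar> * (c + c)"])
    show "G \<in> borel_measurable (euclid {..p})"
      unfolding G_def using k' by measurable
    fix w assume w: "w \<in> unit_disc {..p}"
    have "norm (tangential s k (Suc p) 1 w + tangential s k (Suc p) (-1) w) \<le> c + c"
      using c[of 1 w] c[of "-1" w] w by (intro norm_triangle_mono) auto
    thus "norm (G w) \<le> \<bar>s\<bar> * (c + c)" unfolding G_def by (auto intro!: mult_left_mono)
    have "height {..p} w \<noteq> 0" using height_pos[OF w] by simp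
    thus "G w = height {..p} w *\<^sub>R (?D 1 w - ?D (-1) w)"
      using k by (simp add: G_def tangential_def normal_def algebra_simps)
    show "((\<lambda>t. f (?P 1 (w(k := t))) - f (?P (-1) (w(k := t)))) has_vector_derivative ?D 1 w - ?D (-1) w) (at (w k))"
      using sphere_deriv[OF _ w _ s(2) k, of 1] sphere_deriv[OF _ w _ s(2) k, of "-1"] s
      by (intro has_vector_derivative_diff) auto
    show "continuous_on {t. (\<Sum>i\<in>{..p}. ((w(k := t)) i)\<^sup>2) \<le> 1}
        (\<lambda>t. f (?P 1 (w(k := t))) - f (?P (-1) (w(k := t))))"
      using s k by (intro continuous_on_diff sphere_continuous) auto
  next
    fix w assume "(\<Sum>k\<in>{..p}. (w k)\<^sup>2) = (1::real)"
    thus "f (?P 1 w) - f (?P (-1) w) = 0" by (simp add: sphere_point_def height_def)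
  qed (use k' in auto)
  moreover have "integral\<^sup>L (hemisphere {..p}) G =
    (- s) *\<^sub>R (integral\<^sup>L (hemisphere {..p}) (tangential s k (Suc p) 1)
       + integral\<^sup>L (hemisphere {..p}) (tangential s k (Suc p) (-1)))"
    unfolding G_def using k'
    by (subst integral_scaleR_right, subst Bochner_Integration.integral_add)
       (auto intro!: tangential_integrable)
  ultimately show ?thesis using s by simp
qed

text \<open>Rotations in a plane orthogonal to \<open>\<eta>\<close> preserve each hemisphere and its measure.  For
  \<open>F w = f (x + s n)\<close> and rotation invariant \<open>\<psi>\<close> the function \<open>\<psi> (w\<^sub>i \<partial>\<^sub>j - w\<^sub>j \<partial>\<^sub>i) F\<close> equals
  \<open>\<partial>\<^sub>j (w\<^sub>i \<psi> F) - \<partial>\<^sub>i (w\<^sub>j \<psi> F)\<close>, whose integral is zero if \<open>\<psi>\<close> vanishes on the rim.  The density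
  \<open>\<psi> = 1 / h\<close> of the surface measure does not vanish there.  Therefore \<open>1 / h\<close>
  is replaced by \<open>\<psi> \<delta> h = h / (h\<^sup>2 + \<delta>)\<close>, which does and which increases to \<open>1 / h\<close> as \<open>\<delta>\<close> tends
  to zero; the limit is taken by dominated convergence.\<close>

lemma tangential_horizontal:
  assumes \<sigma>: "\<bar>\<sigma>\<bar> = 1" and s: "0 < s" "s \<le> \<epsilon>" and ij: "i \<le> p" "j \<le> p" "i \<noteq> j"
  shows "integral\<^sup>L (hemisphere {..p}) (tangential s i j \<sigma>) = 0"
proof -
  let ?I = "{..p}" let ?P = "\<lambda>w. x + s *\<^sub>R sphere_point \<sigma> w"
  have ij': "i \<le> Suc p" "j \<le> Suc p" using ij by auto
  have [measurable]: "height ?I \<in> borel_measurable (euclid ?I)"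
    "i \<le> p \<Longrightarrow> (\<lambda>w. w i) \<in> borel_measurable (euclid ?I)" for i by simp_all
  define \<psi> where "\<psi> = (\<lambda>\<delta> h. h / (h\<^sup>2 + \<delta>) :: real)"
  define \<psi>' where "\<psi>' = (\<lambda>\<delta> h. (\<delta> - h\<^sup>2) / (h\<^sup>2 + \<delta>)\<^sup>2 :: real)"
  have \<psi>: "(\<psi> \<delta> has_real_derivative \<psi>' \<delta> h) (at h)" if "\<delta> > 0" for \<delta> h
  proof -
    have "h\<^sup>2 + \<delta> \<noteq> 0" using that by (metis add.commute add_pos_nonneg less_irrefl zero_le_power2)
    thus ?thesis unfolding \<psi>_def \<psi>'_def
      by (auto intro!: derivative_eq_intros simp: power2_eq_square field_simps)
  qed
  have \<psi>_bound: "\<bar>\<psi> \<delta> h\<bar> \<le> 1 / \<delta>" "\<bar>\<psi>' \<delta> h\<bar> \<le> 1 / \<delta>" "\<bar>h * \<psi> \<delta> h\<bar> \<le> 1"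
    if "\<delta> > 0" "0 \<le> h" "h \<le> 1" for \<delta> h
  proof -
    show "\<bar>\<psi> \<delta> h\<bar> \<le> 1 / \<delta>" unfolding \<psi>_def using that by (auto intro!: frac_le)
    have "\<bar>\<delta> - h\<^sup>2\<bar> \<le> h\<^sup>2 + \<delta>" using that by (simp add: abs_le_iff)
    hence "\<bar>\<psi>' \<delta> h\<bar> \<le> (h\<^sup>2 + \<delta>) / (h\<^sup>2 + \<delta>)\<^sup>2"
      unfolding \<psi>'_def abs_divide using that by (simp add: divide_right_mono)
    also have "\<dots> = 1 / (h\<^sup>2 + \<delta>)" by (simp add: power2_eq_square)
    also have "\<dots> \<le> 1 / \<delta>" using that by (intro frac_le) auto
    finally show "\<bar>\<psi>' \<delta> h\<bar> \<le> 1 / \<delta>" .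
    show "\<bar>h * \<psi> \<delta> h\<bar> \<le> 1" unfolding \<psi>_def using that
      by (simp add: power2_eq_square[symmetric] divide_le_eq_1 add_nonneg_pos)
  qed
  have [measurable]: "(\<lambda>w. \<psi> \<delta> (height ?I w)) \<in> borel_measurable (euclid ?I)"
    "(\<lambda>w. \<psi>' \<delta> (height ?I w)) \<in> borel_measurable (euclid ?I)" for \<delta>
    unfolding \<psi>_def \<psi>'_def by measurable
  \<comment> \<open>\<open>G \<delta> i j\<close> is \<open>h\<close> times the derivative of \<open>w\<^sub>i \<psi> F\<close> in direction \<open>j\<close>.\<close>
  define G where "G = (\<lambda>\<delta> i j w. w i *\<^sub>R ((\<psi> \<delta> (height ?I w) * s) *\<^sub>R
      (height ?I w *\<^sub>R partial_on_ball j (?P w) - (\<sigma> * w j) *\<^sub>R partial_on_ball (Suc p) (?P w))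
      - (\<psi>' \<delta> (height ?I w) * w j) *\<^sub>R value_on_ball (?P w)))"
  obtain c where c: "c \<ge> 0" "\<And>y. norm (value_on_ball y) \<le> c"
    "\<And>k y. k \<le> Suc p \<Longrightarrow> norm (partial_on_ball k y) \<le> c"
    using on_ball_bounded by metis
  have G_meas[measurable]: "G \<delta> i j \<in> borel_measurable (euclid ?I)" if "i \<le> p" "j \<le> p" for \<delta> i j
  proof -
    have j': "j \<le> Suc p" using that by simp
    have [measurable]: "(\<lambda>w. w i) \<in> borel_measurable (euclid ?I)" "(\<lambda>w. w j) \<in> borel_measurable (euclid ?I)"
      using that by simp_all
    show ?thesis unfolding G_def using j' by measurable
  qed
  have G_bound: "norm (G \<delta> i j w) \<le> 1 / \<delta> * s * (c + c) + 1 / \<delta> * c"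
    if "\<delta> > 0" "i \<le> p" "j \<le> p" and w: "w \<in> unit_disc ?I" for \<delta> i j w
  proof -
    have h: "0 \<le> height ?I w" "height ?I w \<le> 1" using height_pos[OF w] height_le_1 by (auto intro: less_imp_le)
    have wi: "\<bar>w i\<bar> \<le> 1" "\<bar>w j\<bar> \<le> 1" using abs_coord_le_1[OF _ _ w] that by auto
    have "norm (height ?I w *\<^sub>R partial_on_ball j (?P w) - (\<sigma> * w j) *\<^sub>R partial_on_ball (Suc p) (?P w)) \<le> 1 * c + 1 * c"
      using h wi c that \<sigma>
      by (intro order_trans[OF norm_triangle_ineq4] add_mono; unfold norm_scaleR; intro mult_mono)
         (auto simp: abs_mult)
    hence a: "norm ((\<psi> \<delta> (height ?I w) * s) *\<^sub>R
      (height ?I w *\<^sub>R partial_on_ball j (?P w) - (\<sigma> * w j) *\<^sub>R partial_on_ball (Suc p) (?P w)))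
       \<le> (1 / \<delta> * s) * (c + c)"
      using \<psi>_bound(1)[OF \<open>\<delta> > 0\<close> h] s \<open>\<delta> > 0\<close> unfolding norm_scaleR real_norm_def abs_mult
      by (intro mult_mono) auto
    have b: "norm ((\<psi>' \<delta> (height ?I w) * w j) *\<^sub>R value_on_ball (?P w)) \<le> 1 / \<delta> * 1 * c"
      unfolding norm_scaleR real_norm_def abs_mult
      using \<psi>_bound(2)[OF \<open>\<delta> > 0\<close> h] c wi \<open>\<delta> > 0\<close> by (intro mult_mono) auto
    have "norm (G \<delta> i j w) \<le> 1 * (1 / \<delta> * s * (c + c) + 1 / \<delta> * 1 * c)"
      unfolding G_def norm_scaleR real_norm_def
      using wi a b by (intro mult_mono order_trans[OF norm_triangle_ineq4] add_mono) auto
    thus ?thesis by simp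
  qed
  have G_zero: "integral\<^sup>L (hemisphere ?I) (G \<delta> i j) = 0" if \<delta>: "\<delta> > 0" and ij: "i \<le> p" "j \<le> p" "i \<noteq> j" for \<delta> i j
  proof (rule integral_hemisphere_deriv[where i = j and K = "\<lambda>w. (w i * \<psi> \<delta> (height ?I w)) *\<^sub>R f (?P w)"
        and K' = "\<lambda>w. (w i * \<psi> \<delta> (height ?I w)) *\<^sub>R (s *\<^sub>R (partial_on_ball j (?P w)
            - (\<sigma> * w j / height {..p} w) *\<^sub>R partial_on_ball (Suc p) (?P w)))
          + (w i * (\<psi>' \<delta> (height ?I w) * (- w j / height ?I w))) *\<^sub>R f (?P w)"])
    show "norm (G \<delta> i j w) \<le> 1 / \<delta> * s * (c + c) + 1 / \<delta> * c" if "w \<in> unit_disc ?I" for w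
      using G_bound that ij \<delta> by auto
    show "G \<delta> i j \<in> borel_measurable (euclid ?I)" using ij by simp
    fix w assume w: "w \<in> unit_disc ?I"
    have "height {..p} w \<noteq> 0" using height_pos[OF w] by simp
    thus "G \<delta> i j w = height ?I w *\<^sub>R ((w i * \<psi> \<delta> (height ?I w)) *\<^sub>R (s *\<^sub>R (partial_on_ball j (?P w)
            - (\<sigma> * w j / height {..p} w) *\<^sub>R partial_on_ball (Suc p) (?P w)))
          + (w i * (\<psi>' \<delta> (height ?I w) * (- w j / height ?I w))) *\<^sub>R f (?P w))"
      using on_ball_eq(1)[OF \<sigma> disc_sum_le[OF w], of s] s
      by (simp add: G_def algebra_simps)
    have j': "j \<in> ?I" using ij by simp
    have D1: "((\<lambda>t. \<psi> \<delta> (height ?I (w(j := t)))) has_real_derivative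
        \<psi>' \<delta> (height ?I w) * (- w j / height ?I w)) (at (w j))"
      using DERIV_chain2[of "\<psi> \<delta>" _ "\<lambda>t. height ?I (w(j := t))" "w j", OF \<psi>[OF \<delta>]
          height_has_derivative[OF finite_atMost j' w]] by simp
    have D2: "((\<lambda>t. w i * \<psi> \<delta> (height ?I (w(j := t)))) has_real_derivative
        w i * (\<psi>' \<delta> (height ?I w) * (- w j / height ?I w))) (at (w j))"
      by (rule DERIV_cmult[OF D1])
    have D3: "((\<lambda>t. (w i * \<psi> \<delta> (height ?I (w(j := t)))) *\<^sub>R f (?P (w(j := t)))) has_vector_derivative
        (w i * \<psi> \<delta> (height ?I (w(j := w j)))) *\<^sub>R (s *\<^sub>R (partial_on_ball j (?P w)
            - (\<sigma> * w j / height {..p} w) *\<^sub>R partial_on_ball (Suc p) (?P w)))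
          + (w i * (\<psi>' \<delta> (height ?I w) * (- w j / height ?I w))) *\<^sub>R f (?P (w(j := w j)))) (at (w j))"
      using s by (intro has_vector_derivative_scaleR[OF D2 sphere_deriv[OF \<sigma> w _ _ ij(2)]]) auto
    thus "((\<lambda>t. ((w(j := t)) i * \<psi> \<delta> (height ?I (w(j := t)))) *\<^sub>R f (?P (w(j := t)))) has_vector_derivative
        (w i * \<psi> \<delta> (height ?I w)) *\<^sub>R (s *\<^sub>R (partial_on_ball j (?P w)
            - (\<sigma> * w j / height {..p} w) *\<^sub>R partial_on_ball (Suc p) (?P w)))
          + (w i * (\<psi>' \<delta> (height ?I w) * (- w j / height ?I w))) *\<^sub>R f (?P w)) (at (w j))"
      using ij by simp
    have "(height ?I v)\<^sup>2 + \<delta> \<noteq> 0" for v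
      using \<delta> by (metis add.commute add_pos_nonneg less_irrefl zero_le_power2)
    moreover have "continuous_on S (\<lambda>t. height ?I (w(j := t)))" for S
      unfolding height_def sum_squares_upd[OF finite_atMost j'] by (intro continuous_intros)
    ultimately have "continuous_on {t. (\<Sum>k\<in>?I. ((w(j := t)) k)\<^sup>2) \<le> 1}
        (\<lambda>t. (w i * \<psi> \<delta> (height ?I (w(j := t)))) *\<^sub>R f (?P (w(j := t))))"
      unfolding \<psi>_def using s ij
      by (intro continuous_on_scaleR continuous_on_mult continuous_on_divide continuous_on_add
          continuous_on_power continuous_on_const sphere_continuous[OF \<sigma>]) auto
    thus "continuous_on {t. (\<Sum>k\<in>?I. ((w(j := t)) k)\<^sup>2) \<le> 1}
        (\<lambda>t. ((w(j := t)) i * \<psi> \<delta> (height ?I (w(j := t)))) *\<^sub>R f (?P (w(j := t))))"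
      using ij by simp
  next
    fix w assume "(\<Sum>k\<in>?I. (w k)\<^sup>2) = (1::real)"
    thus "(w i * \<psi> \<delta> (height ?I w)) *\<^sub>R f (?P w) = 0" by (simp add: \<psi>_def height_def)
  qed (use ij in auto)
  have G_int: "integrable (hemisphere ?I) (G \<delta> i j)" if "\<delta> > 0" "i \<le> p" "j \<le> p" for \<delta> i j
    using G_bound[OF that] G_meas[OF that(2,3)] by (intro integrable_hemisphere) auto
  \<comment> \<open>In the antisymmetrized expression the terms with \<open>\<psi>'\<close> and with \<open>\<partial>\<^sub>\<eta> f\<close> cancel.\<close>
  have G_diff: "G \<delta> i j w - G \<delta> j i w =
      s *\<^sub>R ((height ?I w * \<psi> \<delta> (height ?I w)) *\<^sub>R tangential s i j \<sigma> w)" for \<delta> w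
    using ij by (simp add: G_def tangential_def normal_def algebra_simps)
  have zero: "(\<integral>w. (height ?I w * \<psi> \<delta> (height ?I w)) *\<^sub>R tangential s i j \<sigma> w \<partial>hemisphere ?I) = 0"
    if "\<delta> > 0" for \<delta>
  proof -
    have "(\<integral>w. G \<delta> i j w - G \<delta> j i w \<partial>hemisphere ?I) = 0"
      using G_int[OF that] G_zero[OF that] ij by (subst Bochner_Integration.integral_diff) auto
    thus ?thesis unfolding G_diff integral_scaleR_right using s by simp
  qed
  obtain b where b: "\<And>w. w \<in> unit_disc ?I \<Longrightarrow> norm (tangential s i j \<sigma> w) \<le> b"
    using \<sigma> ij' tangential_bounded by metis
  let ?\<delta> = "\<lambda>n. 1 / real (Suc n)"
  have "(\<lambda>n. \<integral>w. (height ?I w * \<psi> (?\<delta> n) (height ?I w)) *\<^sub>R tangential s i j \<sigma> w \<partial>hemisphere ?I)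
      \<longlonglongrightarrow> integral\<^sup>L (hemisphere ?I) (tangential s i j \<sigma>)"
  proof (rule integral_dominated_convergence[where w = "\<lambda>_. b"])
    show "tangential s i j \<sigma> \<in> borel_measurable (hemisphere ?I)" using ij' by measurable
    show "(\<lambda>w. (height ?I w * \<psi> (?\<delta> n) (height ?I w)) *\<^sub>R tangential s i j \<sigma> w)
        \<in> borel_measurable (hemisphere ?I)" for n using ij' by measurable
    interpret finite_measure "hemisphere ?I" by (rule finite_measure_hemisphere) auto
    show "integrable (hemisphere ?I) (\<lambda>_. b)" by simp
    show "AE w in hemisphere ?I. (\<lambda>n. (height ?I w * \<psi> (?\<delta> n) (height ?I w)) *\<^sub>R tangential s i j \<sigma> w)
        \<longlonglongrightarrow> tangential s i j \<sigma> w"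
    proof (rule AE_hemisphere)
      fix w assume "w \<in> unit_disc ?I"
      hence h: "height ?I w \<noteq> 0" using height_pos by force
      have "(\<lambda>n. height ?I w * (height ?I w / ((height ?I w)\<^sup>2 + ?\<delta> n)))
          \<longlonglongrightarrow> height ?I w * (height ?I w / ((height ?I w)\<^sup>2 + 0))"
        using h by (intro tendsto_intros LIMSEQ_Suc[OF lim_1_over_n]) auto
      hence "(\<lambda>n. height ?I w * \<psi> (?\<delta> n) (height ?I w)) \<longlonglongrightarrow> 1"
        using h by (simp add: \<psi>_def power2_eq_square)
      from tendsto_scaleR[OF this tendsto_const[of "tangential s i j \<sigma> w"]]
      show "(\<lambda>n. (height ?I w * \<psi> (?\<delta> n) (height ?I w)) *\<^sub>R tangential s i j \<sigma> w)
        \<longlonglongrightarrow> tangential s i j \<sigma> w" by simp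
    qed simp
    show "AE w in hemisphere ?I. norm ((height ?I w * \<psi> (?\<delta> n) (height ?I w)) *\<^sub>R tangential s i j \<sigma> w) \<le> b" for n
    proof (rule AE_hemisphere)
      fix w assume w: "w \<in> unit_disc ?I"
      have "\<bar>height ?I w * \<psi> (?\<delta> n) (height ?I w)\<bar> \<le> 1"
        using height_pos[OF w] height_le_1 by (intro \<psi>_bound(3)) (auto intro: less_imp_le)
      thus "norm ((height ?I w * \<psi> (?\<delta> n) (height ?I w)) *\<^sub>R tangential s i j \<sigma> w) \<le> b"
        using mult_mono[of _ 1, OF _ b[OF w]] by simp
    qed simp
  qed
  moreover have "?\<delta> n > 0" for n by simp
  ultimately have "(\<lambda>n::nat. 0) \<longlonglongrightarrow> integral\<^sup>L (hemisphere ?I) (tangential s i j \<sigma>)"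
    by (simp only: zero)
  thus ?thesis by (simp add: LIMSEQ_const_iff)
qed

lemma sum_tangential_eq_0:
  assumes s: "0 < s" "s \<le> \<epsilon>" and kl: "k \<le> Suc p" "l \<le> Suc p"
  shows "integral\<^sup>L (hemisphere {..p}) (tangential s k l 1)
       + integral\<^sup>L (hemisphere {..p}) (tangential s k l (-1)) = 0"
proof -
  have swap: "tangential s k l \<sigma> = (\<lambda>w. - tangential s l k \<sigma> w)" for k l \<sigma>
    by (simp add: tangential_def fun_eq_iff)
  consider "k = l" | "k \<le> p" "l \<le> p" "k \<noteq> l" | "k \<le> p" "l = Suc p" | "k = Suc p" "l \<le> p"
    using kl by linarith
  thus ?thesis
  proof cases
    case 1
    hence "tangential s k l \<sigma> = (\<lambda>_. 0)" for \<sigma> by (simp add: tangential_def fun_eq_iff)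
    thus ?thesis by simp
  next
    case 2
    thus ?thesis using tangential_horizontal s by simp
  next
    case 3
    thus ?thesis using tangential_mixed s by simp
  next
    case 4
    thus ?thesis using tangential_mixed[OF s 4(2)] unfolding swap[of k l] by (simp add: add_eq_0_iff)
  qed
qed

end
section \<open>The mean value formula\<close>

locale monogenic_ball = C1_ball +
  assumes monogenic: "\<And>y. y \<in> V \<Longrightarrow> slice_D p \<eta> f y = 0"
begin

text \<open>The derivative of \<open>f\<close> in the direction of the outer normal, on the sphere of radius \<open>s\<close>.\<close>

definition radial :: "real \<Rightarrow> real \<Rightarrow> (nat \<Rightarrow> real) \<Rightarrow> octonion" where
  "radial s \<sigma> w =
    (\<Sum>k\<le>Suc p. normal \<sigma> w k *\<^sub>R partial_on_ball k (x + s *\<^sub>R sphere_point \<sigma> w))"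

text \<open>The heart of the proof and the only place where \<open>D f = 0\<close> enters.  Expanding the right-hand side,
  the terms \<open>cnj v\<^sub>k (v\<^sub>l (n\<^sub>k \<partial>\<^sub>l f))\<close> sum to \<open>cnj n (D f) = 0\<close>.  In the terms
  \<open>cnj v\<^sub>k (v\<^sub>l (n\<^sub>l \<partial>\<^sub>k f))\<close> the two frame vectors are exchanged by the Clifford relation: this leaves
  \<open>2 n\<^sub>k \<partial>\<^sub>k f\<close> on the diagonal, and the rest again sums to \<open>cnj n (D f)\<close>.\<close>

lemma radial_eq_tangential:
  assumes "\<bar>\<sigma>\<bar> = 1" "w \<in> unit_disc {..p}" "0 \<le> s" "s \<le> \<epsilon>"
  shows "radial s \<sigma> w =
    - (1/2) *\<^sub>R (\<Sum>k\<le>Suc p. \<Sum>l\<le>Suc p. oct_cnj (dir k) \<odot> (dir l \<odot> tangential s k l \<sigma> w))"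
proof -
  define n where "n = normal \<sigma> w"
  define d where "d = (\<lambda>k. partial_on_ball k (x + s *\<^sub>R sphere_point \<sigma> w))"
  define A where "A = (\<lambda>k l a. oct_cnj (dir k) \<odot> (dir l \<odot> a))"
  have A: "A k l (a - b) = A k l a - A k l b" "A k l (c *\<^sub>R a) = c *\<^sub>R A k l a" for k l a b c
    by (simp_all add: A_def oct_mult.diff_right oct_mult.scaleR_right)
  have "x + s *\<^sub>R sphere_point \<sigma> w \<in> V"
    using scaled_point_mem[OF assms(1) disc_sum_le[OF assms(2)] assms(3,4)] ball by auto
  from monogenic[OF this] have "(\<Sum>l\<le>Suc p. dir l \<odot> d l) = 0"
    using on_ball_eq(2)[OF assms(1) disc_sum_le[OF assms(2)] assms(3,4)]
    by (simp add: slice_D_def d_def dir_def)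
  hence D: "(\<Sum>l\<le>Suc p. A k l (d l)) = 0" for k
    unfolding A_def oct_mult.sum_right[symmetric] by (simp add: oct_mult.zero_right)
  have swap: "A k l a = (if k = l then 2 else 0) *\<^sub>R a - A l k a" if "k \<le> Suc p" "l \<le> Suc p" for k l a
    using oct_cnj_mult_polarized[of "dir k" "dir l" a] inner_dir[OF that]
    by (simp add: A_def algebra_simps split: if_splits)
  have "(\<Sum>k\<le>Suc p. \<Sum>l\<le>Suc p. A k l (n k *\<^sub>R d l)) = 0"
    unfolding A scaleR_sum_right[symmetric] D by simp
  moreover have "(\<Sum>k\<le>Suc p. \<Sum>l\<le>Suc p. A k l (n l *\<^sub>R d k)) = 2 *\<^sub>R (\<Sum>k\<le>Suc p. n k *\<^sub>R d k)"
  proof -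
    have "(\<Sum>k\<le>Suc p. \<Sum>l\<le>Suc p. A k l (n l *\<^sub>R d k)) =
        (\<Sum>k\<le>Suc p. \<Sum>l\<le>Suc p. (if k = l then 2 *\<^sub>R (n k *\<^sub>R d k) else 0) - A l k (n l *\<^sub>R d k))"
      by (intro sum.cong refl) (subst swap, auto)
    also have "\<dots> = (\<Sum>k\<le>Suc p. 2 *\<^sub>R (n k *\<^sub>R d k)) - (\<Sum>k\<le>Suc p. \<Sum>l\<le>Suc p. A l k (n l *\<^sub>R d k))"
      unfolding sum_subtractf by (intro arg_cong2[of _ _ _ _ minus] sum.cong refl) (simp add: sum.delta')
    also have "(\<Sum>k\<le>Suc p. \<Sum>l\<le>Suc p. A l k (n l *\<^sub>R d k)) = (\<Sum>l\<le>Suc p. \<Sum>k\<le>Suc p. A l k (n l *\<^sub>R d k))"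
      by (rule sum.swap)
    also have "\<dots> = 0" unfolding A scaleR_sum_right[symmetric] D by simp
    finally show ?thesis by (simp only: scaleR_sum_right diff_zero)
  qed
  ultimately have "(\<Sum>k\<le>Suc p. \<Sum>l\<le>Suc p. A k l (n k *\<^sub>R d l - n l *\<^sub>R d k)) = - (2 *\<^sub>R (\<Sum>k\<le>Suc p. n k *\<^sub>R d k))"
    unfolding A(1) sum_subtractf by simp
  thus ?thesis by (simp add: radial_def tangential_def A_def n_def d_def)
qed

lemma radial_measurable:
  "(\<lambda>(w, s). radial s \<sigma> w) \<in> borel_measurable (euclid {..p} \<Otimes>\<^sub>M lborel)"
proof -
  have "(\<lambda>(w, s). normal \<sigma> w k *\<^sub>R partial_on_ball k (x + s *\<^sub>R sphere_point \<sigma> w))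
     \<in> borel_measurable (euclid {..p} \<Otimes>\<^sub>M lborel)" if "k \<le> Suc p" for k
    using that by measurable
  thus ?thesis unfolding radial_def case_prod_unfold by (intro borel_measurable_sum) auto
qed

lemma radial_bounded:
  obtains c where "\<And>s \<sigma> w. \<lbrakk>\<bar>\<sigma>\<bar> = 1; w \<in> unit_disc {..p}\<rbrakk> \<Longrightarrow> norm (radial s \<sigma> w) \<le> c"
proof -
  obtain c where c: "c \<ge> 0" "\<And>k y. k \<le> Suc p \<Longrightarrow> norm (partial_on_ball k y) \<le> c"
    using on_ball_bounded by metis
  have "norm (radial s \<sigma> w) \<le> (\<Sum>k\<le>Suc p. c)"
    if "\<bar>\<sigma>\<bar> = 1" "w \<in> unit_disc {..p}" for s \<sigma> w
    unfolding radial_def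
    using mult_mono[OF abs_normal_le_1[OF that] c(2)] c(1) by (intro sum_norm_le) auto
  thus ?thesis by (rule that)
qed

lemma integral_radial_eq_0:
  assumes s: "0 < s" "s \<le> \<epsilon>"
  shows "integral\<^sup>L (hemisphere {..p}) (radial s 1) + integral\<^sup>L (hemisphere {..p}) (radial s (-1)) = 0"
proof -
  let ?T = "\<lambda>\<sigma> k l. integral\<^sup>L (hemisphere {..p}) (tangential s k l \<sigma>)"
  let ?A = "\<lambda>k l a. oct_cnj (dir k) \<odot> (dir l \<odot> a)"
  have bl: "bounded_linear (?A k l)" for k l
    by (intro bounded_linear_compose[OF oct_mult.bounded_linear_right] oct_mult.bounded_linear_right)
  have "integral\<^sup>L (hemisphere {..p}) (radial s \<sigma>) =
      - (1/2) *\<^sub>R (\<Sum>k\<le>Suc p. \<Sum>l\<le>Suc p. ?A k l (?T \<sigma> k l))" if \<sigma>: "\<bar>\<sigma>\<bar> = 1" for \<sigma>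
  proof -
    have m: "radial s \<sigma> \<in> borel_measurable (euclid {..p})"
      unfolding radial_def by (intro borel_measurable_sum) (use le_Suc_eq in measurable)
    have i: "integrable (hemisphere {..p}) (\<lambda>w. ?A k l (tangential s k l \<sigma> w))"
      if "k \<le> Suc p" "l \<le> Suc p" for k l
      using tangential_integrable[OF \<sigma> that] by (rule integrable_bounded_linear[OF bl])
    have "integral\<^sup>L (hemisphere {..p}) (radial s \<sigma>) = (\<integral>w. - (1/2) *\<^sub>R
        (\<Sum>k\<le>Suc p. \<Sum>l\<le>Suc p. ?A k l (tangential s k l \<sigma> w)) \<partial>hemisphere {..p})"
      using radial_eq_tangential[OF \<sigma>] s m i
      by (intro integral_cong_AE AE_hemisphere)
         (auto intro!: borel_measurable_scaleR borel_measurable_sum borel_measurable_integrable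
           simp del: sum.atMost_Suc)
    also have "\<dots> = - (1/2) *\<^sub>R (\<Sum>k\<le>Suc p. \<Sum>l\<le>Suc p. ?A k l (?T \<sigma> k l))"
      unfolding integral_scaleR_right
      using i tangential_integrable[OF \<sigma>]
      by (subst Bochner_Integration.integral_sum,
          fastforce intro: Bochner_Integration.integrable_sum,
          intro arg_cong[where f = "(*\<^sub>R) _"] sum.cong refl,
          subst Bochner_Integration.integral_sum)
         (auto simp: integral_bounded_linear[OF bl] simp del: sum.atMost_Suc intro!: sum.cong)
    finally show ?thesis .
  qed
  from this[of 1] this[of "-1"]
  have "integral\<^sup>L (hemisphere {..p}) (radial s 1) + integral\<^sup>L (hemisphere {..p}) (radial s (-1)) =
     - (1/2) *\<^sub>R (\<Sum>k\<le>Suc p. \<Sum>l\<le>Suc p. ?A k l (?T 1 k l + ?T (-1) k l))"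
    by (simp add: oct_mult.add_right sum.distrib scaleR_add_right del: sum.atMost_Suc)
  also have "\<dots> = 0"
    using sum_tangential_eq_0[OF s] by (simp add: oct_mult.zero_right del: sum.atMost_Suc)
  finally show ?thesis .
qed

lemma radial_FTC:
  assumes \<sigma>: "\<bar>\<sigma>\<bar> = 1" and w: "w \<in> unit_disc {..p}"
  shows "(\<integral>s. indicator {0..\<epsilon>} s *\<^sub>R radial s \<sigma> w \<partial>lborel) =
    f (x + \<epsilon> *\<^sub>R sphere_point \<sigma> w) - f x"
proof -
  note sq = disc_sum_le[OF w]
  have "((\<lambda>s. radial s \<sigma> w) has_integral
      (f (x + \<epsilon> *\<^sub>R sphere_point \<sigma> w) - f (x + 0 *\<^sub>R sphere_point \<sigma> w))) {0..\<epsilon>}"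
  proof (rule fundamental_theorem_of_calculus)
    fix s assume s: "s \<in> {0..\<epsilon>}"
    have "x + t *\<^sub>R sphere_point \<sigma> w \<in> slice p \<eta>" for t
      using x subspace_slice sphere_point_mem by (intro subspace_add subspace_scale) auto
    moreover have "((\<lambda>s. x + s *\<^sub>R sphere_point \<sigma> w) has_vector_derivative sphere_point \<sigma> w) (at s)"
      by (auto intro!: derivative_eq_intros)
    moreover have "x + s *\<^sub>R sphere_point \<sigma> w \<in> V"
      using scaled_point_mem[OF \<sigma> sq] s ball by auto
    ultimately have "((\<lambda>s. f (x + s *\<^sub>R sphere_point \<sigma> w)) has_vector_derivative
      (\<Sum>k\<le>Suc p. (sphere_point \<sigma> w \<bullet> dir k) *\<^sub>R partial (dir k) f (x + s *\<^sub>R sphere_point \<sigma> w))) (at s)"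
      by (intro slice_chain_rule[OF V C1])
    moreover have "(\<Sum>k\<le>Suc p. (sphere_point \<sigma> w \<bullet> dir k) *\<^sub>R partial (dir k) f (x + s *\<^sub>R sphere_point \<sigma> w))
       = radial s \<sigma> w"
      unfolding radial_def using s on_ball_eq(2)[OF \<sigma> sq, of s]
      by (intro sum.cong) (auto simp: sphere_point_inner_dir)
    ultimately show "((\<lambda>s. f (x + s *\<^sub>R sphere_point \<sigma> w)) has_vector_derivative radial s \<sigma> w) (at s within {0..\<epsilon>})"
      by (simp add: has_vector_derivative_at_within)
  qed (use \<epsilon> in simp)
  moreover have si: "set_integrable lborel {0..\<epsilon>} (\<lambda>s. radial s \<sigma> w)"
  proof -
    obtain c where c: "\<And>s. norm (radial s \<sigma> w) \<le> c" using radial_bounded \<sigma> w by metis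
    have "w \<in> space (euclid {..p})" using w by (simp add: unit_disc_def)
    hence [measurable]: "(\<lambda>s. radial s \<sigma> w) \<in> borel_measurable lborel"
      using measurable_compose[OF measurable_Pair1' radial_measurable] by simp
    show ?thesis unfolding set_integrable_def
    proof (rule Bochner_Integration.integrable_bound[of _ "\<lambda>s. indicator {0..\<epsilon>} s * c"])
      show "integrable lborel (\<lambda>s. indicator {0..\<epsilon>} s * c)"
        by (intro integrable_mult_left integrable_real_indicator) (auto simp: emeasure_lborel_Icc_eq)
    qed (use c in \<open>auto simp: indicator_def intro!: AE_I2 order_trans[OF c]\<close>)
  qed
  ultimately show ?thesis
    using set_borel_integral_eq_integral(2)[OF si] by (simp add: set_lebesgue_integral_def integral_unique)
qed

text \<open>The increments \<open>f (x + \<epsilon> n) - f x\<close> integrate to zero over the sphere: write them as integrals of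
  the radial derivative and exchange the order of integration.\<close>

lemma integral_increment_eq_0:
  "(\<integral>w. value_on_ball (x + \<epsilon> *\<^sub>R sphere_point 1 w) - f x \<partial>hemisphere {..p})
   + (\<integral>w. value_on_ball (x + \<epsilon> *\<^sub>R sphere_point (-1) w) - f x \<partial>hemisphere {..p}) = 0"
proof -
  let ?\<mu> = "hemisphere {..p}"
  interpret finite_measure ?\<mu> by (rule finite_measure_hemisphere) auto
  interpret pair_sigma_finite ?\<mu> lborel ..
  have R[measurable]: "(\<lambda>(w, s). radial s \<sigma> w) \<in> borel_measurable (?\<mu> \<Otimes>\<^sub>M lborel)" for \<sigma>
    using radial_measurable by (simp cong: measurable_cong_sets sets_pair_measure_cong)
  have increment: "(\<integral>w. value_on_ball (x + \<epsilon> *\<^sub>R sphere_point \<sigma> w) - f x \<partial>?\<mu>) =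
      (\<integral>s. indicator {0..\<epsilon>} s *\<^sub>R integral\<^sup>L ?\<mu> (radial s \<sigma>) \<partial>lborel)"
    and int: "integrable lborel (\<lambda>s. indicator {0..\<epsilon>} s *\<^sub>R integral\<^sup>L ?\<mu> (radial s \<sigma>))"
    if \<sigma>: "\<bar>\<sigma>\<bar> = 1" for \<sigma>
  proof -
    obtain c where c: "\<And>s w. w \<in> unit_disc {..p} \<Longrightarrow> norm (radial s \<sigma> w) \<le> c"
      using radial_bounded \<sigma> by metis
    have I: "integrable (?\<mu> \<Otimes>\<^sub>M lborel) (\<lambda>(w, s). indicator {0..\<epsilon>} s *\<^sub>R radial s \<sigma> w)"
    proof (rule Fubini_integrable)
      show m: "(\<lambda>(w, s). indicator {0..\<epsilon>} s *\<^sub>R radial s \<sigma> w) \<in> borel_measurable (?\<mu> \<Otimes>\<^sub>M lborel)"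
        by measurable
      have b: "norm (indicator {0..\<epsilon>} s *\<^sub>R radial s \<sigma> w) \<le> indicator {0..\<epsilon>} s * c"
        if "w \<in> unit_disc {..p}" for w s using c[OF that] by (simp add: indicator_def)
      have ic: "integrable lborel (\<lambda>s. indicator {0..\<epsilon>} s * c)"
        by (intro integrable_mult_left integrable_real_indicator) (auto simp: emeasure_lborel_Icc_eq)
      have i: "integrable lborel (\<lambda>s. indicator {0..\<epsilon>} s *\<^sub>R radial s \<sigma> w)"
        if w: "w \<in> unit_disc {..p}" for w
      proof (rule Bochner_Integration.integrable_bound[of _ "\<lambda>s. indicator {0..\<epsilon>} s * c"])
        have "w \<in> space ?\<mu>" using w by (simp add: unit_disc_def hemisphere_def)
        thus "(\<lambda>s. indicator {0..\<epsilon>} s *\<^sub>R radial s \<sigma> w) \<in> borel_measurable lborel"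
          using measurable_compose[OF measurable_Pair1' m] by simp
      qed (use b[OF w] ic in \<open>auto intro!: AE_I2 order_trans[OF _ abs_ge_self]\<close>)
      show "AE w in ?\<mu>. integrable lborel (\<lambda>s. case (w, s) of (w, s) \<Rightarrow> indicator {0..\<epsilon>} s *\<^sub>R radial s \<sigma> w)"
        using i by (intro AE_hemisphere) auto
      show "integrable ?\<mu> (\<lambda>w. \<integral>s. norm (case (w, s) of (w, s) \<Rightarrow> indicator {0..\<epsilon>} s *\<^sub>R radial s \<sigma> w) \<partial>lborel)"
      proof (rule integrable_hemisphere[where c = "\<integral>s. indicator {0..\<epsilon>} s * c \<partial>lborel"])
        show "(\<lambda>w. \<integral>s. norm (case (w, s) of (w, s) \<Rightarrow> indicator {0..\<epsilon>} s *\<^sub>R radial s \<sigma> w) \<partial>lborel)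
            \<in> borel_measurable (euclid {..p})"
          using m by measurable
        fix w assume w: "w \<in> unit_disc {..p}"
        have "(\<integral>s. norm (indicator {0..\<epsilon>} s *\<^sub>R radial s \<sigma> w) \<partial>lborel) \<le> (\<integral>s. indicator {0..\<epsilon>} s * c \<partial>lborel)"
          using i[OF w] b[OF w] ic by (intro integral_mono integrable_norm) auto
        thus "norm (\<integral>s. norm (case (w, s) of (w, s) \<Rightarrow> indicator {0..\<epsilon>} s *\<^sub>R radial s \<sigma> w) \<partial>lborel)
            \<le> (\<integral>s. indicator {0..\<epsilon>} s * c \<partial>lborel)" by simp
      qed auto
    qed
    have "(\<integral>w. value_on_ball (x + \<epsilon> *\<^sub>R sphere_point \<sigma> w) - f x \<partial>?\<mu>) =
      (\<integral>w. (\<integral>s. indicator {0..\<epsilon>} s *\<^sub>R radial s \<sigma> w \<partial>lborel) \<partial>?\<mu>)"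
    proof (rule integral_cong_AE)
      show "AE w in ?\<mu>. value_on_ball (x + \<epsilon> *\<^sub>R sphere_point \<sigma> w) - f x =
          (\<integral>s. indicator {0..\<epsilon>} s *\<^sub>R radial s \<sigma> w \<partial>lborel)"
        using \<epsilon> by (intro AE_hemisphere) (simp_all add: radial_FTC[OF \<sigma>] on_ball_eq(1)[OF \<sigma> disc_sum_le])
      show "(\<lambda>w. value_on_ball (x + \<epsilon> *\<^sub>R sphere_point \<sigma> w) - f x) \<in> borel_measurable ?\<mu>"
        by measurable
      show "(\<lambda>w. \<integral>s. indicator {0..\<epsilon>} s *\<^sub>R radial s \<sigma> w \<partial>lborel) \<in> borel_measurable ?\<mu>"
        by measurable
    qed
    also have "\<dots> = (\<integral>s. (\<integral>w. indicator {0..\<epsilon>} s *\<^sub>R radial s \<sigma> w \<partial>?\<mu>) \<partial>lborel)"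
      by (rule Fubini_integral[OF I, symmetric])
    finally show "(\<integral>w. value_on_ball (x + \<epsilon> *\<^sub>R sphere_point \<sigma> w) - f x \<partial>?\<mu>) =
      (\<integral>s. indicator {0..\<epsilon>} s *\<^sub>R integral\<^sup>L ?\<mu> (radial s \<sigma>) \<partial>lborel)" by simp
    show "integrable lborel (\<lambda>s. indicator {0..\<epsilon>} s *\<^sub>R integral\<^sup>L ?\<mu> (radial s \<sigma>))"
      using integrable_snd[OF I] by simp
  qed
  have "(\<integral>w. value_on_ball (x + \<epsilon> *\<^sub>R sphere_point 1 w) - f x \<partial>?\<mu>)
     + (\<integral>w. value_on_ball (x + \<epsilon> *\<^sub>R sphere_point (-1) w) - f x \<partial>?\<mu>) =
     (\<integral>s. indicator {0..\<epsilon>} s *\<^sub>R (integral\<^sup>L ?\<mu> (radial s 1) + integral\<^sup>L ?\<mu> (radial s (-1))) \<partial>lborel)"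
    using increment int by (simp add: scaleR_add_right)
  also have "\<dots> = (\<integral>s. 0 \<partial>(lborel :: real measure))"
  proof (rule integral_cong_AE)
    \<comment> \<open>The sphere degenerates for \<open>s = 0\<close>; a single radius is negligible.\<close>
    show "AE s in lborel. indicator {0..\<epsilon>} s *\<^sub>R (integral\<^sup>L ?\<mu> (radial s 1) + integral\<^sup>L ?\<mu> (radial s (-1))) = 0"
      using AE_lborel_singleton[of 0] integral_radial_eq_0
      by (auto simp: indicator_def)
    show "(\<lambda>s. indicator {0..\<epsilon>} s *\<^sub>R (integral\<^sup>L ?\<mu> (radial s 1) + integral\<^sup>L ?\<mu> (radial s (-1))))
      \<in> borel_measurable lborel"
      using borel_measurable_integrable[OF Bochner_Integration.integrable_add[OF int[of 1] int[of "-1"]]]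
      by (simp add: scaleR_add_right)
  qed simp
  finally show ?thesis by simp
qed

end

context C1_ball
begin

text \<open>The substitution \<open>z = x + \<epsilon> w\<close> in the parameter domain turns the two graph integrals that
  constitute the sphere integral into integrals over the unit hemisphere.\<close>

lemma graph_integral_hemisphere:
  assumes \<sigma>: "\<bar>\<sigma>\<bar> = 1"
  defines "q \<equiv> \<lambda>z. \<epsilon>\<^sup>2 - (\<Sum>i\<le>p. (z i - x \<bullet> e i)\<^sup>2)"
  shows "graph_integral p \<eta> {z \<in> space (leb p). q z > 0} (\<lambda>z. x \<bullet> \<eta> + \<sigma> * sqrt (q z)) f =
    \<epsilon> ^ (p + 1) *\<^sub>R (\<integral>w. value_on_ball (x + \<epsilon> *\<^sub>R sphere_point \<sigma> w) \<partial>hemisphere {..p})"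
proof -
  let ?I = "{..p}" let ?T = "{z \<in> space (euclid {..p}). q z > 0}"
  let ?pt = "\<lambda>z. paravec p z + (x \<bullet> \<eta> + \<sigma> * sqrt (q z)) *\<^sub>R \<eta>"
  let ?A = "\<lambda>w. \<lambda>i\<in>?I. x \<bullet> e i + \<epsilon> * w i"
  have q_meas[measurable]: "q \<in> borel_measurable (euclid ?I)" unfolding q_def by measurable
  have [measurable]: "paravec p \<in> borel_measurable (euclid ?I)" unfolding paravec_def by measurable
  define H where "H = (\<lambda>z. (indicator ?T z * (\<epsilon> / sqrt (q z))) *\<^sub>R value_on_ball (?pt z))"
  have H[measurable]: "H \<in> borel_measurable (euclid ?I)" unfolding H_def by measurable
  \<comment> \<open>The classical surface element of the graph.\<close>
  have jacobian: "sqrt (1 + (\<Sum>i\<le>p. (deriv (\<lambda>t. x \<bullet> \<eta> + \<sigma> * sqrt (q (z(i := t)))) (z i))\<^sup>2)) = \<epsilon> / sqrt (q z)"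
    if z: "q z > 0" for z
  proof -
    have d: "deriv (\<lambda>t. x \<bullet> \<eta> + \<sigma> * sqrt (q (z(i := t)))) (z i) = - \<sigma> * (z i - x \<bullet> e i) / sqrt (q z)"
      if i: "i \<le> p" for i
    proof (rule DERIV_imp_deriv)
      have "q (z(i := t)) = q z + (z i - x \<bullet> e i)\<^sup>2 - (t - x \<bullet> e i)\<^sup>2" for t
      proof -
        have "(\<Sum>k\<in>?I - {i}. ((z(i := t)) k - x \<bullet> e k)\<^sup>2) = (\<Sum>k\<in>?I - {i}. (z k - x \<bullet> e k)\<^sup>2)"
          by (intro sum.cong) auto
        thus ?thesis unfolding q_def using i by (subst (1 2) sum.remove[of _ i]) auto
      qed
      hence q: "(\<lambda>t. x \<bullet> \<eta> + \<sigma> * sqrt (q (z(i := t)))) =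
        (\<lambda>t. x \<bullet> \<eta> + \<sigma> * sqrt (q z + (z i - x \<bullet> e i)\<^sup>2 - (t - x \<bullet> e i)\<^sup>2))" by simp
      show "((\<lambda>t. x \<bullet> \<eta> + \<sigma> * sqrt (q (z(i := t)))) has_real_derivative
          - \<sigma> * (z i - x \<bullet> e i) / sqrt (q z)) (at (z i))"
        unfolding q using z by (auto intro!: derivative_eq_intros simp: field_simps)
    qed
    have "\<sigma>\<^sup>2 = 1" using \<sigma> by (metis abs_square_eq_1)
    hence "(\<Sum>i\<le>p. (deriv (\<lambda>t. x \<bullet> \<eta> + \<sigma> * sqrt (q (z(i := t)))) (z i))\<^sup>2) = (\<Sum>i\<le>p. (z i - x \<bullet> e i)\<^sup>2 / q z)"
      using z by (intro sum.cong refl) (simp add: d power_divide power_mult_distrib)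
    also have "\<dots> = (\<epsilon>\<^sup>2 - q z) / q z" by (simp add: sum_divide_distrib[symmetric] q_def)
    finally have "1 + (\<Sum>i\<le>p. (deriv (\<lambda>t. x \<bullet> \<eta> + \<sigma> * sqrt (q (z(i := t)))) (z i))\<^sup>2) = \<epsilon>\<^sup>2 / q z"
      using z by (simp add: field_simps)
    thus ?thesis using \<epsilon> by (simp add: real_sqrt_divide)
  qed
  \<comment> \<open>The points of the graph lie on the sphere, so that \<open>f\<close> may be replaced by its extension by zero.\<close>
  have mem: "?pt z \<in> slice p \<eta> \<inter> cball x \<epsilon>" if z: "q z > 0" for z
  proof -
    have "?pt z - x = paravec p (\<lambda>i. z i - x \<bullet> e i) + (\<sigma> * sqrt (q z)) *\<^sub>R \<eta>"
      by (subst slice_point_coords[OF x])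
         (simp add: paravec_def sum_subtractf scaleR_diff_left algebra_simps)
    hence "(norm (?pt z - x))\<^sup>2 = (\<Sum>i\<le>p. (z i - x \<bullet> e i)\<^sup>2) + (\<sigma> * sqrt (q z))\<^sup>2"
      by (simp only: norm_slice_point)
    also have "(\<sigma> * sqrt (q z))\<^sup>2 = q z" using \<sigma> z by (simp add: power_mult_distrib abs_square_eq_1)
    finally have "(norm (?pt z - x))\<^sup>2 = \<epsilon>\<^sup>2" by (simp add: q_def)
    hence "norm (?pt z - x) = \<epsilon>" using \<epsilon> by (simp add: power2_eq_iff_nonneg)
    thus ?thesis using slice_point_mem by (simp add: dist_norm norm_minus_commute)
  qed
  have "graph_integral p \<eta> {z \<in> space (leb p). q z > 0} (\<lambda>z. x \<bullet> \<eta> + \<sigma> * sqrt (q z)) f = integral\<^sup>L (euclid ?I) H"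
    unfolding graph_integral_def leb_def set_lebesgue_integral_def H_def
    by (intro Bochner_Integration.integral_cong refl)
       (use mem in \<open>auto simp: indicator_def jacobian value_on_ball_def\<close>)
  also have "\<dots> = \<epsilon> ^ (p + 1) *\<^sub>R (\<integral>w. H (?A w) \<partial>euclid ?I)"
    using integral_euclid_affine[OF _ \<epsilon> H, of "\<lambda>i. x \<bullet> e i"] by simp
  also have "(\<integral>w. H (?A w) \<partial>euclid ?I) =
    (\<integral>w. (indicator (unit_disc ?I) w / height ?I w) *\<^sub>R value_on_ball (x + \<epsilon> *\<^sub>R sphere_point \<sigma> w) \<partial>euclid ?I)"
  proof (intro Bochner_Integration.integral_cong refl)
    fix w assume w: "w \<in> space (euclid ?I)"
    have q: "q (?A w) = \<epsilon>\<^sup>2 * (1 - (\<Sum>i\<le>p. (w i)\<^sup>2))"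
      by (simp add: q_def power_mult_distrib sum_distrib_left algebra_simps)
    hence s: "sqrt (q (?A w)) = \<epsilon> * height ?I w" using \<epsilon> by (simp add: height_def real_sqrt_mult)
    have ind: "indicator ?T (?A w) = (indicator (unit_disc ?I) w :: real)"
      using w \<epsilon> by (auto simp: indicator_def unit_disc_def q zero_less_mult_iff space_PiM)
    have "paravec p (?A w) = paravec p (\<lambda>i. x \<bullet> e i) + \<epsilon> *\<^sub>R paravec p w"
      by (simp add: paravec_def scaleR_add_left sum.distrib scaleR_sum_right)
    hence "?pt (?A w) = (paravec p (\<lambda>i. x \<bullet> e i) + (x \<bullet> \<eta>) *\<^sub>R \<eta>) + \<epsilon> *\<^sub>R sphere_point \<sigma> w"
      unfolding s by (simp add: sphere_point_def algebra_simps)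
    hence "?pt (?A w) = x + \<epsilon> *\<^sub>R sphere_point \<sigma> w" using slice_point_coords[OF x] by simp
    thus "H (?A w) = (indicator (unit_disc ?I) w / height ?I w) *\<^sub>R value_on_ball (x + \<epsilon> *\<^sub>R sphere_point \<sigma> w)"
      unfolding H_def ind s using \<epsilon> by simp
  qed
  also have "\<dots> = (\<integral>w. value_on_ball (x + \<epsilon> *\<^sub>R sphere_point \<sigma> w) \<partial>hemisphere ?I)"
    by (rule integral_hemisphere[symmetric]) auto
  finally show ?thesis .
qed

lemma sphere_integral_hemispheres:
  "sphere_integral p \<eta> x \<epsilon> f = \<epsilon> ^ (p + 1) *\<^sub>R
     ((\<integral>w. value_on_ball (x + \<epsilon> *\<^sub>R sphere_point 1 w) \<partial>hemisphere {..p})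
      + (\<integral>w. value_on_ball (x + \<epsilon> *\<^sub>R sphere_point (-1) w) \<partial>hemisphere {..p}))"
  using graph_integral_hemisphere[of 1] graph_integral_hemisphere[of "-1"]
  by (simp add: sphere_integral_def Let_def scaleR_add_right)

lemma measure_hemisphere: "measure (hemisphere {..p}) (space (hemisphere {..p})) = surface_area p / 2"
proof -
  have "{..p} = insert p {..<p}" by auto
  hence "emeasure (hemisphere {..p}) (space (hemisphere {..p})) = ennreal (pi * unit_ball_vol p)"
    using emeasure_hemisphere[of "{..<p}" p] by simp
  thus ?thesis by (simp add: measure_def surface_area_eq)
qed

end

theorem (in monogenic_ball) mean_value:
  "f x = (1 / (surface_area p * \<epsilon> ^ (p + 1))) *\<^sub>R sphere_integral p \<eta> x \<epsilon> f"
proof -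
  let ?\<mu> = "hemisphere {..p}" let ?v = "\<lambda>\<sigma> w. value_on_ball (x + \<epsilon> *\<^sub>R sphere_point \<sigma> w)"
  interpret finite_measure ?\<mu> by (rule finite_measure_hemisphere) auto
  obtain c where "\<And>y. norm (value_on_ball y) \<le> c" using on_ball_bounded by metis
  hence "integrable ?\<mu> (?v \<sigma>)" for \<sigma> by (intro integrable_hemisphere) auto
  hence "(\<integral>w. ?v \<sigma> w - f x \<partial>?\<mu>) = integral\<^sup>L ?\<mu> (?v \<sigma>) - (surface_area p / 2) *\<^sub>R f x" for \<sigma>
    by (simp add: measure_hemisphere)
  hence "(integral\<^sup>L ?\<mu> (?v 1) - (surface_area p / 2) *\<^sub>R f x)
      + (integral\<^sup>L ?\<mu> (?v (-1)) - (surface_area p / 2) *\<^sub>R f x) = 0"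
    using integral_increment_eq_0 by simp
  hence "integral\<^sup>L ?\<mu> (?v 1) + integral\<^sup>L ?\<mu> (?v (-1)) =
      (surface_area p / 2) *\<^sub>R f x + (surface_area p / 2) *\<^sub>R f x"
    unfolding add_diff_add[symmetric] by (rule eq_iff_diff_eq_0[THEN iffD2])
  also have "\<dots> = surface_area p *\<^sub>R f x" by (simp flip: scaleR_add_left)
  finally have "sphere_integral p \<eta> x \<epsilon> f = (\<epsilon> ^ (p + 1) * surface_area p) *\<^sub>R f x"
    by (simp add: sphere_integral_hemispheres)
  moreover have "surface_area p > 0" by (simp add: surface_area_eq)
  ultimately show ?thesis using \<epsilon> by simp
qed

text \<open>Points on the sphere are limits of points of the ball on the same radius.  Hence a domain that
  contains the ball and its relative boundary contains the closed ball.\<close>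

lemma (in slice_direction) sphere_subset_slice_boundary:
  assumes x: "x \<in> slice p \<eta>" and \<epsilon>: "\<epsilon> > 0" and y: "y \<in> slice p \<eta>" "norm (y - x) = \<epsilon>"
  shows "y \<in> slice_boundary p \<eta> (slice_ball p \<eta> x \<epsilon>)"
proof -
  have "\<exists>y'. y' \<in> slice_ball p \<eta> x \<epsilon> \<and> y' \<in> T" if T: "y \<in> T" "openin (top_of_set (slice p \<eta>)) T" for T
  proof -
    obtain d where d: "d > 0" "\<And>y'. y' \<in> slice p \<eta> \<Longrightarrow> dist y' y < d \<Longrightarrow> y' \<in> T"
      using T unfolding openin_euclidean_subtopology_iff by blast
    define t where "t = min (1/2) (d / (2 * \<epsilon>))"
    have t: "0 < t" "t < 1" "t * \<epsilon> < d"
    proof -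
      have "t \<le> d / (2 * \<epsilon>)" by (simp add: t_def)
      hence "t * \<epsilon> \<le> d / 2" using \<epsilon> by (simp add: field_simps)
      thus "t * \<epsilon> < d" using d by simp
    qed (use d \<epsilon> in \<open>auto simp: t_def\<close>)
    let ?y = "y - t *\<^sub>R (y - x)"
    have "?y \<in> slice p \<eta>" using x y subspace_slice by (intro subspace_diff subspace_scale)
    moreover have "?y - x = (1 - t) *\<^sub>R (y - x)" by (simp add: algebra_simps)
    hence "norm (?y - x) = (1 - t) * \<epsilon>" using t y by simp
    hence "norm (?y - x) < \<epsilon>" using t \<epsilon> by simp
    moreover have "dist ?y y < d" using t y by (simp add: dist_norm)
    ultimately show ?thesis using d(2) by (auto simp: slice_ball_def)
  qed
  hence "y \<in> (top_of_set (slice p \<eta>)) closure_of (slice_ball p \<eta> x \<epsilon>)"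
    using y by (auto simp: closure_of_def)
  moreover have "y \<notin> (top_of_set (slice p \<eta>)) interior_of (slice_ball p \<eta> x \<epsilon>)"
    using interior_of_subset y by (fastforce simp: slice_ball_def)
  ultimately show ?thesis by (simp add: slice_boundary_def frontier_of_def)
qed

theorem theorem4p9:
  fixes p :: nat and \<eta> x :: octonion and U :: "octonion set"
    and f :: "octonion \<Rightarrow> octonion" and \<epsilon> :: real
  assumes "p \<le> 6"
    and "\<eta> \<in> imag_sphere p"
    and "open U" and "connected U"
    and "smooth_boundary p \<eta> (U \<inter> slice p \<eta>)"
    and "Ck_on p \<eta> 1 (U \<inter> slice p \<eta>) f"
    and "\<forall>y \<in> U \<inter> slice p \<eta>. slice_D p \<eta> f y = 0"
    and "x \<in> U \<inter> slice p \<eta>"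
    and "\<epsilon> > 0"
    and "slice_ball p \<eta> x \<epsilon> \<subseteq> U \<inter> slice p \<eta>"
    and "slice_boundary p \<eta> (slice_ball p \<eta> x \<epsilon>) \<subseteq> U \<inter> slice p \<eta>"
  shows "f x = (1 / (surface_area p * \<epsilon> ^ (p + 1))) *\<^sub>R sphere_integral p \<eta> x \<epsilon> f"
proof -
  interpret slice_direction p \<eta> by unfold_locales (fact assms)+
  have "monogenic_ball p \<eta> (U \<inter> slice p \<eta>) f x \<epsilon>"
  proof unfold_locales
    show "openin (top_of_set (slice p \<eta>)) (U \<inter> slice p \<eta>)"
      using \<open>open U\<close> by (metis inf_commute openin_open_Int)
    show "slice p \<eta> \<inter> cball x \<epsilon> \<subseteq> U \<inter> slice p \<eta>"
    proof
      fix y assume y: "y \<in> slice p \<eta> \<inter> cball x \<epsilon>"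
      hence "norm (y - x) < \<epsilon> \<or> norm (y - x) = \<epsilon>"
        by (auto simp: dist_norm norm_minus_commute)
      thus "y \<in> U \<inter> slice p \<eta>"
      proof
        assume "norm (y - x) < \<epsilon>"
        hence "y \<in> slice_ball p \<eta> x \<epsilon>" using y by (simp add: slice_ball_def)
        thus ?thesis using assms by blast
      next
        assume "norm (y - x) = \<epsilon>"
        hence "y \<in> slice_boundary p \<eta> (slice_ball p \<eta> x \<epsilon>)"
          using assms y by (intro sphere_subset_slice_boundary) auto
        thus ?thesis using assms by blast
      qed
    qed
  qed (use assms in auto)
  thus ?thesis by (rule monogenic_ball.mean_value)
qed

end
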